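(* Let $n,m$ be integers with $n\ge 3$ and $2\le m<n$. Let $\mathbf V$ be an $(n+1)$-dimensional real vector space with a hyperplane ($n$-dimensional linear subspace) $\mathbf I$ equipped with a positive definite inner product, and let $\mathbf W$ be an $(m+1)$-dimensional real vector space with a hyperplane $\mathbf J$ equipped with a positive definite inner product. Let $f:\mathbf V\to\mathbf W$ be a linear mapping such that $\ker f\not\subset\mathbf I$ and $f(\mathbf V)=\mathbf W$, so that the induced projective linear mapping $$\phi:\mathcal P(\mathbf V)\setminus\mathcal P(\ker f)\to\mathcal P(\mathbf W),\qquad \mathbb R\mathbf x\mapsto\mathbb R(f(\mathbf x))$$ is central and surjective. Let $\{\mathbf b_0,\dots,\mathbf b_n\}$ be a basis of $\mathbf V$ such that $\{\mathbf b_1,\dots,\mathbf b_n\}$ is an orthonormal basis of $\mathbf I$, and let $\{\mathbf c_0,\dots,\mathbf c_m\}$ be a basis of $\mathbf W$ such that $\{\mathbf c_1,\dots,\mathbf c_m\}$ is an orthonormal basis of $\mathbf J$. Let $A=(a_{ij})_{0\le i\le m,\,0\le j\le n}$ be the coordinate matrix of $f$ with respect to these bases, i.e. $f(\mathbf b_j)=\sum_{i=0}^m a_{ij}\mathbf c_i$ for $j=0,\dots,n$. Put $$\mathbf a_i:=(a_{i1},\dots,a_{in})\in\mathbb R^n\quad\text{for } i=0,\dots,m,$$ and let $\widetilde A$ be the real $m\times n$ matrix whose $i$-th row ($i=1,\dots,m$) is $$\mathbf a_i-\frac{\mathbf a_0\cdot\mathbf a_i}{\mathbf a_0\cdot\mathbf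 a_0}\,\mathbf a_0 ,$$ where $\cdot$ is the standard inner product of $\mathbb R^n$. Then the following assertions hold. 1. $\phi$ is decomposable into a central projection followed by a similarity if, and only if, the least singular value of the matrix $\widetilde A$ has multiplicity $\ge 2m-n+1$. 2. $\phi$ is decomposable into an orthogonal central projection followed by a similarity if, and only if, there exists a real number $v>0$ such that $\widetilde A\,\widetilde A^{\mathrm T}=\mathrm{diag}(v,\dots,v)$.
   Context: For a real vector space $\mathbf U$, $\mathcal P(\mathbf U)$ denotes the projective space on $\mathbf U$, whose points are the one-dimensional subspaces $\mathbb R\mathbf x$ ($\mathbf x\ne 0$). $\mathcal P(\mathbf I)$ and $\mathcal P(\mathbf J)$ are regarded as the hyperplanes at infinity of $\mathcal P(\mathbf V)$ and $\mathcal P(\mathbf W)$, so $\mathcal P(\mathbf V)\setminus\mathcal P(\mathbf I)$ and $\mathcal P(\mathbf W)\setminus\mathcal P(\mathbf J)$ are projectively embedded Euclidean spaces of dimensions $n$ and $m$ (without a distinguished unit segment). The mapping $\phi$ is called central because its exceptional subspace $\mathcal P(\ker f)$ is not contained in $\mathcal P(\mathbf I)$. Under the hypotheses one has $\mathbf a_0\cdot\mathbf a_0\ne 0$, so $\widetilde A$ is well defined. Decompositions. For a complementary subspace $\mathbf T$ of $\ker f$ in $\mathbf V$ (i.e. $\mathbf V=\mathbf T\oplus\ker f$), let $\psi_{\mathbf T}:\mathcal P(\mathbf V)\setminus\mathcal P(\ker f)\to\mathcal P(\mathbf T)$ be the projection with exceptional subspace $\mathcal P(\ker f)$ onto $\mathcal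 P(\mathbf T)$ (induced by the linear projection of $\mathbf V$ onto $\mathbf T$ with kernel $\ker f$), and let $\phi_{\mathbf T}:=\phi|_{\mathcal P(\mathbf T)}:\mathcal P(\mathbf T)\to\mathcal P(\mathbf W)$, which is a collineation. Then $\phi=\phi_{\mathbf T}\circ\psi_{\mathbf T}$, and every decomposition of $\phi$ into a projection followed by a collineation is of this form. The collineation $\phi_{\mathbf T}$ is a similarity if $\mathbf T\not\subset\mathbf I$, $f(\mathbf T\cap\mathbf I)=\mathbf J$, and the restriction $f|_{\mathbf T\cap\mathbf I}:\mathbf T\cap\mathbf I\to\mathbf J$ is a positive scalar multiple of a linear isometry (with respect to the inner product on $\mathbf T\cap \mathbf I$ inherited from $\mathbf I$ and the one on $\mathbf J$). "$\phi$ is decomposable into a central projection followed by a similarity" means: there is a complement $\mathbf T$ of $\ker f$ in $\mathbf V$ such that $\phi_{\mathbf T}$ is a similarity. For $\mathbf T\not\subset\mathbf I$, the projection $\psi_{\mathbf T}$ is called an orthogonal central projection if $\mathcal P(\mathbf T)$ is orthogonal to $\mathcal P(\ker f)$, meaning that $(\mathbf T\cap\mathbf I)^\perp\subset\ker f\cap\mathbf I$ or $(\mathbf T\cap\mathbf I)^\perp\supset\ker f\cap\mathbf I$, where $\perp$ denotes the orthogonal complement in $\mathbf I$. "$\phi$ is decomposable into an orthogonal central projection followed by a similarity" means: there is a complement $\mathbf T$ of $\ker f$ in $\mathbf V$ such that $\psi_{\mathbf T}$ is an orthogonal central projection and $\phi_{\mathbf T}$ is a similarity. Singular values. The singular values of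 a real matrix $B$ are the positive square roots of the nonzero (hence positive) eigenvalues of $B^{\mathrm T}B$; in particular, all singular values are positive, and zero is not counted as one. The multiplicity of a singular value $\sigma$ is the multiplicity of $\sigma^2$ as an eigenvalue of $B^{\mathrm T}B$ (equivalently, of $BB^{\mathrm T}$). *)

theory Defs
  imports Complex_Main "Jordan_Normal_Form.Char_Poly"
begin

definition inner_product_on :: "'v::real_vector set \<Rightarrow> ('v \<Rightarrow> 'v \<Rightarrow> real) \<Rightarrow> bool" where
  "inner_product_on S g \<longleftrightarrow>
     (\<forall>x\<in>S. \<forall>y\<in>S. g x y = g y x) \<and>
     (\<forall>x\<in>S. \<forall>y\<in>S. \<forall>z\<in>S. g (x + y) z = g x z + g y z) \<and>
     (\<forall>r. \<forall>x\<in>S. \<forall>y\<in>S. g (r *\<^sub>R x) y = r * g x y) \<and>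
     (\<forall>x\<in>S. x \<noteq> 0 \<longrightarrow> 0 < g x x)"

definition orth_compl :: "'v::real_vector set \<Rightarrow> ('v \<Rightarrow> 'v \<Rightarrow> real) \<Rightarrow> 'v set \<Rightarrow> 'v set" where
  "orth_compl I g S = {x \<in> I. \<forall>y\<in>S. g x y = 0}"

definition basis_family :: "nat set \<Rightarrow> (nat \<Rightarrow> 'v::real_vector) \<Rightarrow> 'v set \<Rightarrow> bool" where
  "basis_family N b S \<longleftrightarrow> inj_on b N \<and> independent (b ` N) \<and> span (b ` N) = S"

definition orthonormal_basis_family ::
    "nat set \<Rightarrow> (nat \<Rightarrow> 'v::real_vector) \<Rightarrow> 'v set \<Rightarrow> ('v \<Rightarrow> 'v \<Rightarrow> real) \<Rightarrow> bool" where
  "orthonormal_basis_family N b S g \<longleftrightarrow>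
     basis_family N b S \<and> (\<forall>i\<in>N. \<forall>j\<in>N. g (b i) (b j) = (if i = j then 1 else 0))"

definition lin_kernel :: "('v::real_vector \<Rightarrow> 'w::real_vector) \<Rightarrow> 'v set" where
  "lin_kernel f = {x. f x = 0}"

definition complementary :: "'v::real_vector set \<Rightarrow> 'v set \<Rightarrow> bool" where
  "complementary T K \<longleftrightarrow>
     subspace T \<and> subspace K \<and> T \<inter> K = {0} \<and> {t + k | t k. t \<in> T \<and> k \<in> K} = UNIV"

definition linear_isometry_on ::
    "'v::real_vector set \<Rightarrow> ('v \<Rightarrow> 'v \<Rightarrow> real) \<Rightarrow> 'w::real_vector set \<Rightarrow> ('w \<Rightarrow> 'w \<Rightarrow> real)
      \<Rightarrow> ('v \<Rightarrow> 'w) \<Rightarrow> bool" where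
  "linear_isometry_on S g U g' h \<longleftrightarrow>
     (\<forall>x\<in>S. h x \<in> U) \<and>
     (\<forall>x\<in>S. \<forall>y\<in>S. h (x + y) = h x + h y) \<and>
     (\<forall>r. \<forall>x\<in>S. h (r *\<^sub>R x) = r *\<^sub>R h x) \<and>
     (\<forall>x\<in>S. \<forall>y\<in>S. g' (h x) (h y) = g x y)"

text \<open>
  A point of the projective space on \<open>U\<close> is a one-dimensional subspace, and a linear map \<open>f\<close>
  induces the projective map sending a point \<open>P\<close> outside \<open>proj_space (lin_kernel f)\<close> to the
  image set \<open>f ` P\<close>.
\<close>

definition proj_space :: "'v::real_vector set \<Rightarrow> 'v set set" where
  "proj_space U = {span {x} | x. x \<in> U \<and> x \<noteq> 0}"

definition projection_along :: "'v::real_vector set \<Rightarrow> 'v set \<Rightarrow> 'v \<Rightarrow> 'v" where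
  "projection_along T K x = (THE t. t \<in> T \<and> x - t \<in> K)"

text \<open>
  In the next definitions \<open>(I, g)\<close> and \<open>(J, g')\<close> are the hyperplanes at infinity with their
  inner products. The collineation \<open>\<phi>\<^sub>T\<close> and the projection \<open>\<psi>\<^sub>T\<close> are the projective maps
  induced by \<open>f\<close> restricted to \<open>T\<close> and by \<open>projection_along T (lin_kernel f)\<close>; the lemmas
  \<open>projection_then_collineation\<close> and \<open>collineation_bij\<close> below show that every complement \<open>T\<close>
  of the kernel does give such a decomposition.
\<close>

definition collineation_is_similarity ::
    "'v::real_vector set \<Rightarrow> ('v \<Rightarrow> 'v \<Rightarrow> real) \<Rightarrow> 'w::real_vector set \<Rightarrow> ('w \<Rightarrow> 'w \<Rightarrow> real)
      \<Rightarrow> ('v \<Rightarrow> 'w) \<Rightarrow> 'v set \<Rightarrow> bool" where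
  "collineation_is_similarity I g J g' f T \<longleftrightarrow>
     \<not> T \<subseteq> I \<and> f ` (T \<inter> I) = J \<and>
     (\<exists>r>0. \<exists>h. linear_isometry_on (T \<inter> I) g J g' h \<and> (\<forall>x\<in>T \<inter> I. f x = r *\<^sub>R h x))"

definition projection_is_orthogonal_central ::
    "'v::real_vector set \<Rightarrow> ('v \<Rightarrow> 'v \<Rightarrow> real) \<Rightarrow> ('v \<Rightarrow> 'w::real_vector) \<Rightarrow> 'v set \<Rightarrow> bool" where
  "projection_is_orthogonal_central I g f T \<longleftrightarrow>
     \<not> T \<subseteq> I \<and>
     (orth_compl I g (T \<inter> I) \<subseteq> lin_kernel f \<inter> I \<or> lin_kernel f \<inter> I \<subseteq> orth_compl I g (T \<inter> I))"

definition central_projection_then_similarity ::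
    "'v::real_vector set \<Rightarrow> ('v \<Rightarrow> 'v \<Rightarrow> real) \<Rightarrow> 'w::real_vector set \<Rightarrow> ('w \<Rightarrow> 'w \<Rightarrow> real)
      \<Rightarrow> ('v \<Rightarrow> 'w) \<Rightarrow> bool" where
  "central_projection_then_similarity I g J g' f \<longleftrightarrow>
     (\<exists>T. complementary T (lin_kernel f) \<and> collineation_is_similarity I g J g' f T)"

definition orthogonal_central_projection_then_similarity ::
    "'v::real_vector set \<Rightarrow> ('v \<Rightarrow> 'v \<Rightarrow> real) \<Rightarrow> 'w::real_vector set \<Rightarrow> ('w \<Rightarrow> 'w \<Rightarrow> real)
      \<Rightarrow> ('v \<Rightarrow> 'w) \<Rightarrow> bool" where
  "orthogonal_central_projection_then_similarity I g J g' f \<longleftrightarrow>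
     (\<exists>T. complementary T (lin_kernel f) \<and> projection_is_orthogonal_central I g f T \<and>
          collineation_is_similarity I g J g' f T)"

text \<open>
  \<open>row_vec A i\<close> is row \<open>i\<close> of \<open>A\<close> without its entry in column \<open>0\<close>. In \<open>tilde_mat A\<close> the row
  obtained from \<open>row_vec A i\<close> has matrix index \<open>i - 1\<close>.
\<close>

definition row_vec :: "real mat \<Rightarrow> nat \<Rightarrow> real vec" where
  "row_vec A i = vec (dim_col A - 1) (\<lambda>j. A $$ (i, j + 1))"

definition tilde_mat :: "real mat \<Rightarrow> real mat" where
  "tilde_mat A = mat_of_rows (dim_col A - 1)
     (map (\<lambda>i. row_vec A i -
            ((row_vec A 0 \<bullet> row_vec A i) / (row_vec A 0 \<bullet> row_vec A 0)) \<cdot>\<^sub>v row_vec A 0)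
       [1..<dim_row A])"

definition singular_values :: "real mat \<Rightarrow> real set" where
  "singular_values B = {sqrt e | e. eigenvalue (B\<^sup>T * B) e \<and> e \<noteq> 0}"

definition singular_value_multiplicity :: "real mat \<Rightarrow> real \<Rightarrow> nat" where
  "singular_value_multiplicity B s = Polynomial.order (s\<^sup>2) (char_poly (B\<^sup>T * B))"

lemma subspace_lin_kernel: "linear f \<Longrightarrow> subspace (lin_kernel f)"
  by (auto simp: lin_kernel_def subspace_def linear_0 linear_add linear_scale)

lemma projection_along_props:
  assumes "complementary T K"
  shows "projection_along T K x \<in> T" "x - projection_along T K x \<in> K"
proof -
  have sT: "subspace T" and sK: "subspace K" and TK: "T \<inter> K = {0}"
    using assms by (auto simp: complementary_def)
  have "x \<in> {t + k | t k. t \<in> T \<and> k \<in> K}"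
    using assms by (simp add: complementary_def)
  then obtain t k where t: "t \<in> T" "k \<in> K" "x = t + k" by blast
  have "projection_along T K x \<in> T \<and> x - projection_along T K x \<in> K"
    unfolding projection_along_def
  proof (rule theI[where a = t])
    show "t \<in> T \<and> x - t \<in> K" using t by simp
    fix u assume u: "u \<in> T \<and> x - u \<in> K"
    have "u - t \<in> T" using u t sT by (blast intro: subspace_diff)
    moreover have "(x - t) - (x - u) \<in> K" using u t subspace_diff[OF sK]
      by (metis add_diff_cancel_left')
    ultimately have "u - t \<in> T \<inter> K" by simp
    then show "u = t" using TK by simp
  qed
  then show "projection_along T K x \<in> T" "x - projection_along T K x \<in> K" by auto
qed

lemma linear_projection_along:
  assumes "complementary T K"
  shows "linear (projection_along T K)"
proof -
  have sT: "subspace T" and sK: "subspace K" and TK: "T \<inter> K = {0}"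
    using assms by (auto simp: complementary_def)
  have uniq: "projection_along T K x = t" if "t \<in> T" "x - t \<in> K" for x t
  proof -
    let ?p = "projection_along T K x"
    note p = projection_along_props[OF assms, of x]
    have "?p - t \<in> T" using p that sT by (blast intro: subspace_diff)
    moreover have "(x - t) - (x - ?p) \<in> K" using p that sK by (blast intro: subspace_diff)
    ultimately have "?p - t \<in> T \<inter> K" by simp
    then show ?thesis using TK by simp
  qed
  note p = projection_along_props[OF assms]
  show ?thesis
  proof (rule linearI)
    fix x y
    have "(x - projection_along T K x) + (y - projection_along T K y) \<in> K"
      using p sK by (blast intro: subspace_add)
    then show "projection_along T K (x + y) = projection_along T K x + projection_along T K y"
      by (intro uniq subspace_add[OF sT] p) (simp add: algebra_simps)
  next
    fix r x
    have "r *\<^sub>R (x - projection_along T K x) \<in> K"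
      using p sK by (blast intro: subspace_scale)
    then show "projection_along T K (r *\<^sub>R x) = r *\<^sub>R projection_along T K x"
      by (intro uniq subspace_scale[OF sT] p) (simp add: algebra_simps)
  qed
qed

lemma projection_then_collineation:
  assumes f: "linear f" and T: "complementary T (lin_kernel f)"
    and P: "P \<in> proj_space UNIV - proj_space (lin_kernel f)"
  shows "projection_along T (lin_kernel f) ` P \<in> proj_space T"
    and "f ` P = f ` (projection_along T (lin_kernel f) ` P)"
proof -
  let ?p = "projection_along T (lin_kernel f)"
  note p = projection_along_props[OF T]
  obtain x where x: "P = span {x}" "x \<noteq> 0" "x \<notin> lin_kernel f"
    using P unfolding proj_space_def by blast
  have fp: "f (?p y) = f y" for y
    using p(2)[of y] by (simp add: lin_kernel_def linear_diff[OF f])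
  have "?p ` P = span {?p x}"
    using linear_span_image[OF linear_projection_along[OF T], of "{x}"] x by simp
  moreover have "?p x \<noteq> 0" using fp[of x] x linear_0[OF f] by (auto simp: lin_kernel_def)
  ultimately show "?p ` P \<in> proj_space T" using p(1)[of x] unfolding proj_space_def by blast
  show "f ` P = f ` (?p ` P)" by (simp add: image_image fp)
qed

lemma collineation_bij:
  assumes f: "linear f" and T: "complementary T (lin_kernel f)" and sf: "range f = UNIV"
  shows "bij_betw (\<lambda>P. f ` P) (proj_space T) (proj_space UNIV)"
proof -
  have sT: "subspace T" and TK: "T \<inter> lin_kernel f = {0}"
    using T by (auto simp: complementary_def)
  have inj: "inj_on f T"
  proof (rule inj_onI)
    fix x y assume *: "x \<in> T" "y \<in> T" "f x = f y"
    then have "x - y \<in> T \<inter> lin_kernel f"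
      using sT by (auto simp: lin_kernel_def linear_diff[OF f] intro: subspace_diff)
    then show "x = y" using TK by simp
  qed
  have sub: "P \<subseteq> T" if P: "P \<in> proj_space T" for P
  proof -
    obtain x where "P = span {x}" "x \<in> T" using P unfolding proj_space_def by blast
    then show ?thesis using sT by (simp add: span_minimal)
  qed
  have inj_img: "inj_on (\<lambda>P. f ` P) (proj_space T)"
    by (rule inj_onI) (simp add: inj_on_image_eq_iff[OF inj sub sub])
  have image_in: "f ` span {x} \<in> proj_space UNIV" if "x \<in> T" "x \<noteq> 0" for x
  proof -
    have "f x \<noteq> 0" using that TK by (auto simp: lin_kernel_def)
    moreover have "f ` span {x} = span {f x}"
      using linear_span_image[OF f, of "{x}"] by simp
    ultimately show ?thesis unfolding proj_space_def by blast
  qed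
  have image_onto: "\<exists>P\<in>proj_space T. f ` P = span {w}" if w: "w \<noteq> 0" for w
  proof -
    obtain y where y: "f y = w" using sf by (metis surjD)
    let ?t = "projection_along T (lin_kernel f) y"
    note p = projection_along_props[OF T, of y]
    have "f ?t = w" using p(2) y by (simp add: lin_kernel_def linear_diff[OF f])
    moreover from this have "?t \<noteq> 0" using w linear_0[OF f] by auto
    moreover have "f ` span {?t} = span {f ?t}"
      using linear_span_image[OF f, of "{?t}"] by simp
    ultimately show ?thesis using p(1) unfolding proj_space_def by blast
  qed
  show ?thesis
    unfolding bij_betw_def
  proof (intro conjI equalityI subsetI)
    fix Q assume "Q \<in> (\<lambda>P. f ` P) ` proj_space T"
    then obtain x where "x \<in> T" "x \<noteq> 0" "Q = f ` span {x}"
      unfolding proj_space_def by blast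
    then show "Q \<in> proj_space UNIV" using image_in by simp
  next
    fix Q :: "'b set" assume "Q \<in> proj_space UNIV"
    then obtain w where "w \<noteq> 0" "Q = span {w}" unfolding proj_space_def by blast
    then show "Q \<in> (\<lambda>P. f ` P) ` proj_space T"
      using image_onto by (metis image_eqI)
  qed (rule inj_img)
qed

end

theory Submission
  imports Defs
begin

text \<open>
  On \<open>I' = I \<inter> f\<^sup>-\<^sup>1(J) = a\<^sub>0\<^sup>\<bottom>\<close> the map \<open>f\<close> is given by the matrix \<open>A~\<close>, and a complement of \<open>ker f\<close>
  on which \<open>f\<close> is a similarity is the same as an \<open>m\<close>-dimensional \<open>S \<subseteq> I'\<close> that \<open>f\<close> maps onto \<open>J\<close>
  with a constant scale factor \<open>r\<close>. Take an orthonormal basis of right singular vectors \<open>q\<^sub>k\<close> of \<open>A~\<close>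
  containing the direction of \<open>a\<^sub>0\<close>. A right inverse of \<open>f\<close> with image \<open>S\<close> sends \<open>f q\<^sub>k\<close> to
  \<open>q\<^sub>k + y\<^sub>k\<close> with \<open>y\<^sub>k \<in> ker f \<inter> I\<close>, and the scale condition says that the \<open>y\<^sub>k\<close> are orthogonal with
  squared norms \<open>\<sigma>\<^sub>k\<^sup>2 / r\<^sup>2 - 1\<close>. Hence \<open>r \<le> \<sigma>\<^sub>k\<close> for all \<open>k\<close>, and at most \<open>dim (ker f \<inter> I) = n - 1 - m\<close>
  singular values (with multiplicity) differ from \<open>r\<close>; conversely, that many orthogonal \<open>y\<^sub>k\<close> exist.
  In the orthogonal case all \<open>y\<^sub>k\<close> vanish, so all singular values agree.
\<close>

section \<open>Orthogonal diagonalization of real symmetric matrices\<close>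

text \<open>The fundamental theorem of algebra gives an eigenvector \<open>z\<close> over the
  complex numbers. Comparing \<open>y \<bullet> (A *\<^sub>v x)\<close> with
  \<open>x \<bullet> (A *\<^sub>v y)\<close> for its real part \<open>x\<close> and imaginary part
  \<open>y\<close> shows that the eigenvalue is real; then whichever of \<open>x\<close>,
  \<open>y\<close> is nonzero serves.\<close>

lemma symmetric_mat_real_eigenvector:
  fixes A :: "real mat"
  assumes A: "A \<in> carrier_mat n n" and sym: "A\<^sup>T = A" and n: "0 < n"
  shows "\<exists>v e. v \<in> carrier_vec n \<and> v \<bullet> v = 1 \<and> A *\<^sub>v v = e \<cdot>\<^sub>v v"
proof -
  define C where "C = map_mat complex_of_real A"
  have C: "C \<in> carrier_mat n n" using A by (simp add: C_def)
  have "\<not> constant (poly (char_poly C))"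
    using degree_monic_char_poly[OF C] n by (simp add: constant_degree)
  then obtain l where "eigenvalue C l"
    using fundamental_theorem_of_algebra eigenvalue_root_char_poly[OF C] by blast
  then obtain z where z: "z \<in> carrier_vec n" "z \<noteq> 0\<^sub>v n" "C *\<^sub>v z = l \<cdot>\<^sub>v z"
    using C by (auto simp: eigenvalue_def eigenvector_def)
  define x where "x = map_vec Re z"
  define y where "y = map_vec Im z"
  have x: "x \<in> carrier_vec n" and y: "y \<in> carrier_vec n" using z by (auto simp: x_def y_def)
  have comp: "(C *\<^sub>v z) $ i = Complex ((A *\<^sub>v x) $ i) ((A *\<^sub>v y) $ i)" if "i < n" for i
    using that A z(1) unfolding C_def x_def y_def
    by (simp add: scalar_prod_def complex_eq_iff)
  have "Complex ((A *\<^sub>v x) $ i) ((A *\<^sub>v y) $ i) = l * z $ i" if "i < n" for i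
    using comp[OF that] that z by simp
  then have "(A *\<^sub>v x) $ i = Re l * x $ i - Im l * y $ i \<and> (A *\<^sub>v y) $ i = Im l * x $ i + Re l * y $ i"
    if "i < n" for i
    using that z(1) by (auto simp: x_def y_def complex_eq_iff)
  then have Ax: "A *\<^sub>v x = Re l \<cdot>\<^sub>v x - Im l \<cdot>\<^sub>v y" and Ay: "A *\<^sub>v y = Im l \<cdot>\<^sub>v x + Re l \<cdot>\<^sub>v y"
    using A x y by (auto intro!: eq_vecI simp del: index_mult_mat_vec)
  have "y \<bullet> (A *\<^sub>v x) = (A *\<^sub>v y) \<bullet> x"
    using transpose_vec_mult_scalar[OF A x y] by (simp only: sym)
  also have "\<dots> = x \<bullet> (A *\<^sub>v y)"
    using A x y by (intro comm_scalar_prod[of _ n]) auto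
  finally have "Im l * (x \<bullet> x + y \<bullet> y) = 0"
    unfolding Ax Ay using x y comm_scalar_prod[OF y x]
    by (simp add: scalar_prod_add_distrib[of _ n] scalar_prod_minus_distrib[of _ n] algebra_simps)
  moreover have "x \<noteq> 0\<^sub>v n \<or> y \<noteq> 0\<^sub>v n"
    using z(1,2) by (auto simp: x_def y_def vec_eq_iff complex_eq_iff)
  moreover have pos: "0 \<le> u \<bullet> u" "u \<noteq> 0\<^sub>v n \<Longrightarrow> 0 < u \<bullet> u" if "u \<in> carrier_vec n" for u :: "real vec"
    using conjugate_square_ge_0_vec[of u] conjugate_square_greater_0_vec[OF that] by auto
  ultimately have l: "Im l = 0"
    using pos[OF x] pos[OF y] by (smt (verit) mult_eq_0_iff)
  obtain u where u: "u \<in> carrier_vec n" "u \<noteq> 0\<^sub>v n" "A *\<^sub>v u = Re l \<cdot>\<^sub>v u"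
  proof (cases "x = 0\<^sub>v n")
    case True
    moreover have "A *\<^sub>v y = Re l \<cdot>\<^sub>v y"
      unfolding Ay using l x y by (auto intro!: eq_vecI)
    ultimately show ?thesis using that[of y] y \<open>x \<noteq> 0\<^sub>v n \<or> y \<noteq> 0\<^sub>v n\<close> by simp
  next
    case False
    moreover have "A *\<^sub>v x = Re l \<cdot>\<^sub>v x"
      unfolding Ax using l x y by (auto intro!: eq_vecI)
    ultimately show ?thesis using that[of x] x by simp
  qed
  define s where "s = 1 / sqrt (u \<bullet> u)"
  have "(s \<cdot>\<^sub>v u) \<bullet> (s \<cdot>\<^sub>v u) = 1"
    using pos(2)[OF u(1,2)] u(1) by (simp add: s_def)
  moreover have "A *\<^sub>v (s \<cdot>\<^sub>v u) = Re l \<cdot>\<^sub>v (s \<cdot>\<^sub>v u)"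
    using u A by (simp add: mult_mat_vec smult_smult_assoc mult.commute)
  ultimately show ?thesis using u(1) by (metis smult_carrier_vec)
qed

lemma orthogonal_mat_with_first_col:
  fixes v :: "real vec"
  assumes v: "v \<in> carrier_vec n" "v \<bullet> v = 1" and n: "0 < n"
  shows "\<exists>W \<in> carrier_mat n n. W\<^sup>T * W = 1\<^sub>m n \<and> col W 0 = v"
proof -
  \<comment> \<open>the Householder reflection exchanging \<open>v\<close> and the first unit vector;
    for \<open>w = 0\<close> the division makes \<open>c = 0\<close> and \<open>W = 1\<close>\<close>
  define w where "w = v - unit_vec n 0"
  define c where "c = 2 / (w \<bullet> w)"
  define W where "W = mat n n (\<lambda>(i,j). (if i = j then 1 else 0) - c * w $ i * w $ j)"
  have w: "w \<in> carrier_vec n" using v by (simp add: w_def)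
  have W: "W \<in> carrier_mat n n" by (simp add: W_def)
  have wi: "w $ i = v $ i - (if i = 0 then 1 else 0)" if "i < n" for i
    using that v n by (simp add: w_def)
  have ww: "w \<bullet> w = - 2 * w $ 0"
  proof -
    have "w \<bullet> w = v \<bullet> v - 2 * v $ 0 + 1"
      unfolding w_def using v n
      by (simp add: scalar_prod_minus_distrib[of _ n] minus_scalar_prod_distrib[of _ n]
          comm_scalar_prod[of "unit_vec n 0" n])
    then show ?thesis using v wi[OF n] by simp
  qed
  have sum_w: "w \<bullet> w = (\<Sum>k<n. w $ k * w $ k)"
    using w by (simp add: scalar_prod_def atLeast0LessThan)
  have c: "c * (c * (w \<bullet> w)) = 2 * c" by (simp add: c_def)
  have "W\<^sup>T * W = 1\<^sub>m n"
  proof (rule eq_matI)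
    fix i j assume "i < dim_row (1\<^sub>m n :: real mat)" "j < dim_col (1\<^sub>m n :: real mat)"
    then have ij: "i < n" "j < n" by auto
    have "(W\<^sup>T * W) $$ (i,j) = (\<Sum>k<n. ((if k = i then 1 else 0) - c * w $ k * w $ i) *
        ((if k = j then 1 else 0) - c * w $ k * w $ j))"
      using ij W by (simp add: scalar_prod_def W_def atLeast0LessThan)
    also have "\<dots> = (\<Sum>k<n. (if k = i then (if i = j then 1 else 0) - c * w $ i * w $ j else 0)
        - (if k = j then c * w $ i * w $ j else 0) + c * c * w $ i * w $ j * (w $ k * w $ k))"
      by (rule sum.cong) (auto simp: algebra_simps)
    also have "\<dots> = (if i = j then 1 else 0) - 2 * (c * w $ i * w $ j)
        + c * c * w $ i * w $ j * (w \<bullet> w)"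
      using ij by (simp add: sum.distrib sum_subtractf sum_w flip: sum_distrib_left)
    also have "c * c * w $ i * w $ j * (w \<bullet> w) = 2 * (c * w $ i * w $ j)"
      using arg_cong[OF c, of "\<lambda>t. t * (w $ i * w $ j)"] by (simp only: mult_ac)
    also have "(if i = j then 1 else 0) - 2 * (c * w $ i * w $ j) + 2 * (c * w $ i * w $ j) = 1\<^sub>m n $$ (i,j)"
      using ij by simp
    finally show "(W\<^sup>T * W) $$ (i,j) = 1\<^sub>m n $$ (i,j)" .
  qed (use W in auto)
  moreover have "col W 0 = v"
  proof (rule eq_vecI)
    fix i assume "i < dim_vec v"
    then have i: "i < n" using v by simp
    \<comment> \<open>For \<open>w\<close> nonzero, \<open>w \<bullet> w = - 2 * w $ 0\<close> gives
      \<open>c * w $ 0 = -1\<close>, so the first column is the first unit vector plus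
      \<open>w\<close>, which is \<open>v\<close>.\<close>
    have "c * w $ 0 * w $ i = - w $ i"
    proof (cases "w \<bullet> w = 0")
      case True
      then have "w = 0\<^sub>v n" using conjugate_square_eq_0_vec[OF w] by simp
      then show ?thesis using i n by simp
    next
      case False
      then have "c * w $ 0 = -1" using ww by (simp add: c_def)
      then show ?thesis by simp
    qed
    then show "col W 0 $ i = v $ i"
      using i n wi[OF i] by (simp add: W_def mult.assoc mult.left_commute mult.commute)
  qed (use W v in auto)
  ultimately show ?thesis using W by blast
qed

text \<open>In an orthonormal basis starting with the eigenvector \<open>v\<close>, the first column
  of the matrix is \<open>e\<close> times the first unit vector. Symmetry clears the first row as
  well and passes to the remaining block.\<close>

lemma symmetric_mat_deflate:
  fixes A :: "real mat"
  assumes A: "A \<in> carrier_mat (Suc n) (Suc n)" and sym: "A\<^sup>T = A"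
    and v: "v \<in> carrier_vec (Suc n)" "v \<bullet> v = 1" "A *\<^sub>v v = e \<cdot>\<^sub>v v"
  shows "\<exists>W A'. W \<in> carrier_mat (Suc n) (Suc n) \<and> W\<^sup>T * W = 1\<^sub>m (Suc n) \<and> col W 0 = v \<and>
    A' \<in> carrier_mat n n \<and> A'\<^sup>T = A' \<and>
    W\<^sup>T * A * W = four_block_mat (mat 1 1 (\<lambda>_. e)) (0\<^sub>m 1 n) (0\<^sub>m n 1) A'"
proof -
  obtain W where W: "W \<in> carrier_mat (Suc n) (Suc n)" and WW: "W\<^sup>T * W = 1\<^sub>m (Suc n)"
    and Wv: "col W 0 = v"
    using orthogonal_mat_with_first_col[OF v(1,2)] by auto
  define B where "B = W\<^sup>T * A * W"
  have B: "B \<in> carrier_mat (Suc n) (Suc n)" using W A by (simp add: B_def)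
  have Bsym: "B\<^sup>T = B"
    unfolding B_def using W A sym
    by (simp add: transpose_mult[of _ "Suc n" "Suc n" _ "Suc n"] assoc_mult_mat[of _ "Suc n" "Suc n" _ "Suc n" _ "Suc n"])
  have Bsym': "B $$ (i,j) = B $$ (j,i)" if "i < Suc n" "j < Suc n" for i j
    using arg_cong[OF Bsym, of "\<lambda>M. M $$ (i,j)"] that B by simp
  have B0: "B $$ (i,0) = (if i = 0 then e else 0)" if i: "i < Suc n" for i
  proof -
    have "B $$ (i,0) = (W\<^sup>T * (A * W)) $$ (i,0)"
      unfolding B_def using W A by (simp add: assoc_mult_mat[of _ "Suc n" "Suc n" _ "Suc n" _ "Suc n"])
    also have "\<dots> = row W\<^sup>T i \<bullet> col (A * W) 0"
      using W A i by (intro index_mult_mat(1)) auto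
    also have "\<dots> = col W i \<bullet> (A *\<^sub>v v)"
      using W i col_mult2[OF A W, of 0] by (simp only: Wv row_transpose carrier_matD zero_less_Suc)
    also have "\<dots> = e * (W\<^sup>T * W) $$ (i,0)"
      using W i v Wv by simp
    finally show ?thesis using i by (simp add: WW)
  qed
  define A' where "A' = mat n n (\<lambda>(i,j). B $$ (Suc i, Suc j))"
  have "A'\<^sup>T = A'" using Bsym' by (auto simp: A'_def)
  moreover have "B = four_block_mat (mat 1 1 (\<lambda>_. e)) (0\<^sub>m 1 n) (0\<^sub>m n 1) A'"
    using B B0 Bsym' by (auto intro!: eq_matI simp: A'_def)
  ultimately show ?thesis
    using W WW Wv by (intro exI[of _ W] exI[of _ A']) (auto simp: B_def A'_def)
qed

text \<open>The induction hypothesis is a premise, so that one step serves both the plain induction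
  and the version with a prescribed first eigenvector. The block matrix \<open>R\<close> fixes the
  first unit vector, hence \<open>W * R\<close> keeps \<open>v\<close> as its first column.\<close>

lemma symmetric_mat_diagonalize_step:
  fixes A :: "real mat"
  assumes A: "A \<in> carrier_mat (Suc n) (Suc n)" and sym: "A\<^sup>T = A"
    and v: "v \<in> carrier_vec (Suc n)" "v \<bullet> v = 1" "A *\<^sub>v v = e \<cdot>\<^sub>v v"
    and IH: "\<And>A'::real mat. A' \<in> carrier_mat n n \<Longrightarrow> A'\<^sup>T = A' \<Longrightarrow>
      \<exists>Q d. Q \<in> carrier_mat n n \<and> Q\<^sup>T * Q = 1\<^sub>m n \<and> Q\<^sup>T * A' * Q = mat_diag n d"
  shows "\<exists>Q d. Q \<in> carrier_mat (Suc n) (Suc n) \<and> Q\<^sup>T * Q = 1\<^sub>m (Suc n) \<and> col Q 0 = v \<and>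
    Q\<^sup>T * A * Q = mat_diag (Suc n) d"
proof -
  let ?N = "Suc n"
  obtain W A' where W: "W \<in> carrier_mat ?N ?N" and WW: "W\<^sup>T * W = 1\<^sub>m ?N" and Wv: "col W 0 = v"
    and A': "A' \<in> carrier_mat n n" "A'\<^sup>T = A'"
    and WA: "W\<^sup>T * A * W = four_block_mat (mat 1 1 (\<lambda>_. e)) (0\<^sub>m 1 n) (0\<^sub>m n 1) A'"
    using symmetric_mat_deflate[OF A sym v] by blast
  obtain P d where P: "P \<in> carrier_mat n n" "P\<^sup>T * P = 1\<^sub>m n" "P\<^sup>T * A' * P = mat_diag n d"
    using IH[OF A'] by blast
  define R where "R = four_block_mat (1\<^sub>m 1) (0\<^sub>m 1 n) (0\<^sub>m n 1) P"
  have R: "R \<in> carrier_mat ?N ?N" using P by (auto simp: R_def)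
  have RT: "R\<^sup>T = four_block_mat (1\<^sub>m 1) (0\<^sub>m 1 n) (0\<^sub>m n 1) P\<^sup>T"
    unfolding R_def using P by (subst transpose_four_block_mat[of _ 1 1 _ n _ n]) auto
  have block: "four_block_mat (mat 1 1 (\<lambda>_. a)) (0\<^sub>m 1 n) (0\<^sub>m n 1) X *
      four_block_mat (mat 1 1 (\<lambda>_. b)) (0\<^sub>m 1 n) (0\<^sub>m n 1) Y =
      four_block_mat (mat 1 1 (\<lambda>_. a * b)) (0\<^sub>m 1 n) (0\<^sub>m n 1) (X * Y)"
    if "X \<in> carrier_mat n n" "Y \<in> carrier_mat n n" for X Y :: "real mat" and a b
  proof -
    have "mat 1 1 (\<lambda>_. a) * mat 1 1 (\<lambda>_. b) = mat 1 1 (\<lambda>_. a * b)"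
      by (auto simp: scalar_prod_def)
    then show ?thesis
      using that by (subst mult_four_block_mat[of _ 1 1 _ n _ n _ _ 1 _ n]) auto
  qed
  have one: "(1\<^sub>m 1 :: real mat) = mat 1 1 (\<lambda>_. 1)" by auto
  have "R\<^sup>T * R = four_block_mat (mat 1 1 (\<lambda>_. 1)) (0\<^sub>m 1 n) (0\<^sub>m n 1) (1\<^sub>m n)"
    unfolding RT unfolding R_def one using P by (subst block) auto
  then have RR: "R\<^sup>T * R = 1\<^sub>m ?N" by (auto intro!: eq_matI)
  define Q where "Q = W * R"
  have Q: "Q \<in> carrier_mat ?N ?N" using W R by (simp add: Q_def)
  have QT: "Q\<^sup>T = R\<^sup>T * W\<^sup>T" unfolding Q_def using W R by (simp add: transpose_mult)
  note assoc = assoc_mult_mat[of _ ?N ?N _ ?N _ ?N]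
  have conj: "Q\<^sup>T * M * Q = R\<^sup>T * (W\<^sup>T * M * W) * R" if "M \<in> carrier_mat ?N ?N" for M
    unfolding QT unfolding Q_def using that W R by (simp add: assoc)
  have "Q\<^sup>T * Q = R\<^sup>T * (W\<^sup>T * W) * R"
    unfolding QT unfolding Q_def using W R by (simp add: assoc)
  also have "\<dots> = 1\<^sub>m ?N" using R RR by (simp add: WW)
  finally have QQ: "Q\<^sup>T * Q = 1\<^sub>m ?N" .
  have "Q\<^sup>T * A * Q = four_block_mat (mat 1 1 (\<lambda>_. e)) (0\<^sub>m 1 n) (0\<^sub>m n 1) (mat_diag n d)"
    unfolding conj[OF A] WA unfolding RT unfolding R_def one
    using P A' by (subst block, simp, simp, subst block) auto
  also have "\<dots> = mat_diag ?N (\<lambda>k. if k = 0 then e else d (k - 1))"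
    by (rule eq_matI) (auto simp: mat_diag_def)
  finally have QA: "Q\<^sup>T * A * Q = mat_diag ?N (\<lambda>k. if k = 0 then e else d (k - 1))" .
  have "col R 0 = unit_vec ?N 0"
    using P(1) by (auto intro!: eq_vecI simp: R_def)
  then have "col Q 0 = v"
    using W R by (auto intro!: eq_vecI simp: Q_def col_mult2[of _ ?N ?N _ ?N] Wv[symmetric])
  then show ?thesis using Q QQ QA by blast
qed

lemma symmetric_mat_diagonalize:
  fixes A :: "real mat"
  assumes "A \<in> carrier_mat n n" and "A\<^sup>T = A"
  shows "\<exists>Q d. Q \<in> carrier_mat n n \<and> Q\<^sup>T * Q = 1\<^sub>m n \<and> Q\<^sup>T * A * Q = mat_diag n d"
  using assms
proof (induction n arbitrary: A)
  case 0
  then show ?case by (intro exI[of _ "1\<^sub>m 0"] exI[of _ "\<lambda>_. 0"]) (auto simp: mat_diag_def)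
next
  case (Suc n)
  obtain v e where "v \<in> carrier_vec (Suc n)" "v \<bullet> v = 1" "A *\<^sub>v v = e \<cdot>\<^sub>v v"
    using symmetric_mat_real_eigenvector[OF Suc.prems] by auto
  from symmetric_mat_diagonalize_step[OF Suc.prems this Suc.IH] show ?case by blast
qed

lemma symmetric_mat_diagonalize_with_eigenvector:
  fixes A :: "real mat"
  assumes A: "A \<in> carrier_mat n n" and sym: "A\<^sup>T = A"
    and v: "v \<in> carrier_vec n" "v \<bullet> v = 1" "A *\<^sub>v v = e \<cdot>\<^sub>v v"
  shows "\<exists>Q d. Q \<in> carrier_mat n n \<and> Q\<^sup>T * Q = 1\<^sub>m n \<and> col Q 0 = v \<and> Q\<^sup>T * A * Q = mat_diag n d"
proof (cases n)
  case 0
  then show ?thesis using v by (simp add: scalar_prod_def)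
next
  case (Suc k)
  then show ?thesis
    using symmetric_mat_diagonalize_step[of A k v e] symmetric_mat_diagonalize assms by blast
qed

section \<open>Singular values and multiplicities read off a diagonalization\<close>

lemma order_prod_linear_factors:
  fixes d :: "'i \<Rightarrow> 'a::field"
  assumes "finite K"
  shows "Polynomial.order a (\<Prod>k\<in>K. [:- d k, 1:]) = card {k\<in>K. d k = a}"
  using assms
proof (induction K rule: finite_induct)
  case empty
  show ?case by (simp add: order_0I)
next
  case (insert j K)
  have "Polynomial.order a [:- d j, 1:] = (if d j = a then 1 else 0)"
    using order_power_n_n[of a 1] by (auto intro: order_0I)
  moreover have "{k\<in>insert j K. d k = a} = (if d j = a then insert j {k\<in>K. d k = a} else {k\<in>K. d k = a})"
    by auto
  ultimately show ?case
    using insert by (simp add: order_mult del: mult_pCons_left)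
qed

text \<open>For square matrices a left inverse is a right inverse, so conjugation by
  \<open>Q\<close> is a similarity and preserves the characteristic polynomial.\<close>

lemma char_poly_orthogonally_diagonalized:
  fixes A :: "'a::field mat"
  assumes A: "A \<in> carrier_mat n n" and Q: "Q \<in> carrier_mat n n" "Q\<^sup>T * Q = 1\<^sub>m n"
    and D: "Q\<^sup>T * A * Q = mat_diag n d"
  shows "char_poly A = (\<Prod>k<n. [:- d k, 1:])"
proof -
  have QQ: "Q * Q\<^sup>T = 1\<^sub>m n"
    using mat_mult_left_right_inverse[of "Q\<^sup>T" n Q] Q by simp
  have "similar_mat (mat_diag n d) A"
    unfolding similar_mat_def
    by (intro exI, rule similar_mat_witI[of "Q\<^sup>T" Q n]) (use A Q QQ D in auto)
  then have "char_poly A = char_poly (mat_diag n d)" using char_poly_similar by metis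
  also have "\<dots> = (\<Prod>a\<leftarrow>diag_mat (mat_diag n d). [:- a, 1:])"
    by (rule char_poly_upper_triangular[OF mat_diag_dim]) (auto simp: mat_diag_def)
  also have "diag_mat (mat_diag n d) = map d [0..<n]"
    by (auto simp: diag_mat_def mat_diag_def)
  finally show ?thesis
    by (simp add: prod.list_conv_set_nth atLeast0LessThan)
qed

lemma singular_values_diagonalized:
  assumes B: "B \<in> carrier_mat m n" and Q: "Q \<in> carrier_mat n n" "Q\<^sup>T * Q = 1\<^sub>m n"
    and D: "Q\<^sup>T * (B\<^sup>T * B) * Q = mat_diag n d"
  shows "singular_values B = sqrt ` {d k | k. k < n \<and> d k \<noteq> 0}"
    and "singular_value_multiplicity B s = card {k. k < n \<and> d k = s\<^sup>2}"
proof -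
  have BB: "B\<^sup>T * B \<in> carrier_mat n n" using B by simp
  note cp = char_poly_orthogonally_diagonalized[OF BB Q D]
  have "eigenvalue (B\<^sup>T * B) e \<longleftrightarrow> (\<exists>k<n. d k = e)" for e
    by (auto simp: eigenvalue_root_char_poly[OF BB] cp poly_prod)
  then show "singular_values B = sqrt ` {d k | k. k < n \<and> d k \<noteq> 0}"
    by (auto simp: singular_values_def)
  show "singular_value_multiplicity B s = card {k. k < n \<and> d k = s\<^sup>2}"
    by (simp add: singular_value_multiplicity_def cp order_prod_linear_factors)
qed

section \<open>Inner products on subspaces\<close>

text \<open>The form is constrained only on \<open>S\<close>, so its rules carry membership
  premises. The locale is used twice, once for each hyperplane at infinity.\<close>

locale inner_product_subspace =
  fixes S :: "'v::real_vector set" and g :: "'v \<Rightarrow> 'v \<Rightarrow> real"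
  assumes sub: "subspace S" and ip: "inner_product_on S g"
begin

lemma ip_commute: "x \<in> S \<Longrightarrow> y \<in> S \<Longrightarrow> g x y = g y x"
  and ip_add_left: "x \<in> S \<Longrightarrow> y \<in> S \<Longrightarrow> z \<in> S \<Longrightarrow> g (x + y) z = g x z + g y z"
  and ip_scale_left: "x \<in> S \<Longrightarrow> y \<in> S \<Longrightarrow> g (r *\<^sub>R x) y = r * g x y"
  and ip_pos: "x \<in> S \<Longrightarrow> x \<noteq> 0 \<Longrightarrow> 0 < g x x"
  using ip by (auto simp: inner_product_on_def)

lemma ip_add_right: "x \<in> S \<Longrightarrow> y \<in> S \<Longrightarrow> z \<in> S \<Longrightarrow> g x (y + z) = g x y + g x z"
  by (simp add: ip_commute[of x] ip_add_left subspace_add[OF sub])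

lemma ip_scale_right: "x \<in> S \<Longrightarrow> y \<in> S \<Longrightarrow> g x (r *\<^sub>R y) = r * g x y"
  by (simp add: ip_commute[of x] ip_scale_left subspace_scale[OF sub])

lemma ip_zero_left: "x \<in> S \<Longrightarrow> g 0 x = 0"
  using ip_scale_left[of x x 0] by simp

lemma ip_zero_right: "x \<in> S \<Longrightarrow> g x 0 = 0"
  using ip_scale_right[of x x 0] by simp

lemma ip_diff_left: "x \<in> S \<Longrightarrow> y \<in> S \<Longrightarrow> z \<in> S \<Longrightarrow> g (x - y) z = g x z - g y z"
  using ip_add_left[of x "(-1) *\<^sub>R y" z] ip_scale_left[of y z "-1"] subspace_scale[OF sub, of y "-1"]
  by simp

lemma ip_diff_right: "x \<in> S \<Longrightarrow> y \<in> S \<Longrightarrow> z \<in> S \<Longrightarrow> g x (y - z) = g x y - g x z"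
  by (simp add: ip_commute[of x] ip_diff_left subspace_diff[OF sub])

lemma ip_nonneg: "x \<in> S \<Longrightarrow> 0 \<le> g x x"
  using ip_pos[of x] ip_zero_left[of 0] by (cases "x = 0") auto

lemma ip_eq_zero: "x \<in> S \<Longrightarrow> g x x = 0 \<longleftrightarrow> x = 0"
  using ip_pos[of x] ip_zero_left[OF subspace_0[OF sub]] by force

lemma ip_sum_left: "(\<And>k. k \<in> K \<Longrightarrow> x k \<in> S) \<Longrightarrow> y \<in> S \<Longrightarrow> g (\<Sum>k\<in>K. x k) y = (\<Sum>k\<in>K. g (x k) y)"
  by (induction K rule: infinite_finite_induct)
    (auto simp: ip_zero_left ip_add_left subspace_sum[OF sub])

lemma ip_sum_right: "(\<And>k. k \<in> K \<Longrightarrow> x k \<in> S) \<Longrightarrow> y \<in> S \<Longrightarrow> g y (\<Sum>k\<in>K. x k) = (\<Sum>k\<in>K. g y (x k))"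
  by (simp add: ip_commute[of y] ip_sum_left subspace_sum[OF sub])

lemma comb_in: "(\<And>k. k \<in> K \<Longrightarrow> x k \<in> S) \<Longrightarrow> (\<Sum>k\<in>K. u k *\<^sub>R x k) \<in> S"
  by (intro subspace_sum[OF sub] subspace_scale[OF sub])

lemma ip_comb_left:
  assumes "\<And>k. k \<in> K \<Longrightarrow> x k \<in> S" "y \<in> S"
  shows "g (\<Sum>k\<in>K. u k *\<^sub>R x k) y = (\<Sum>k\<in>K. u k * g (x k) y)"
  using assms by (simp add: ip_sum_left subspace_scale[OF sub] ip_scale_left)

lemma ip_comb_right:
  assumes "\<And>k. k \<in> K \<Longrightarrow> x k \<in> S" "y \<in> S"
  shows "g y (\<Sum>k\<in>K. u k *\<^sub>R x k) = (\<Sum>k\<in>K. u k * g y (x k))"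
  using assms by (simp add: ip_sum_right subspace_scale[OF sub] ip_scale_right)

lemma ip_comb_comb:
  assumes "\<And>k. k \<in> K \<Longrightarrow> x k \<in> S" and "finite K"
    and "\<And>k l. k \<in> K \<Longrightarrow> l \<in> K \<Longrightarrow> g (x k) (x l) = (if k = l then d k else 0)"
  shows "g (\<Sum>k\<in>K. u k *\<^sub>R x k) (\<Sum>k\<in>K. v k *\<^sub>R x k) = (\<Sum>k\<in>K. u k * v k * d k)"
proof -
  have "g (\<Sum>k\<in>K. u k *\<^sub>R x k) (\<Sum>k\<in>K. v k *\<^sub>R x k) = (\<Sum>k\<in>K. u k * (\<Sum>l\<in>K. v l * g (x k) (x l)))"
    using assms(1) by (subst ip_comb_left) (simp_all add: ip_comb_right comb_in)
  also have "\<dots> = (\<Sum>k\<in>K. u k * (\<Sum>l\<in>K. if k = l then v l * d k else 0))"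
    by (intro sum.cong refl arg_cong2[of _ _ _ _ "(*)"]) (auto simp: assms(3))
  finally show ?thesis using assms(2) by (simp add: mult.assoc)
qed

lemma orthogonal_family_independent:
  assumes fin: "finite K" and x: "\<And>k. k \<in> K \<Longrightarrow> x k \<in> S" "\<And>k. k \<in> K \<Longrightarrow> x k \<noteq> 0"
    and orth: "\<And>k l. k \<in> K \<Longrightarrow> l \<in> K \<Longrightarrow> k \<noteq> l \<Longrightarrow> g (x k) (x l) = 0"
  shows "inj_on x K" "independent (x ` K)"
proof -
  have pos: "0 < g (x k) (x k)" if "k \<in> K" for k using x[OF that] ip_pos by blast
  show inj: "inj_on x K"
    using orth pos by (intro inj_onI) (metis less_irrefl)
  show "independent (x ` K)"
  proof
    assume "dependent (x ` K)"
    then obtain u where u: "\<exists>v\<in>x ` K. u v \<noteq> 0" "(\<Sum>v\<in>x ` K. u v *\<^sub>R v) = 0"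
      using fin by (auto simp: dependent_finite)
    then obtain k where k: "k \<in> K" "u (x k) \<noteq> 0" by auto
    have "0 = g (\<Sum>l\<in>K. u (x l) *\<^sub>R x l) (x k)"
      using u(2) x k by (simp add: sum.reindex[OF inj] ip_zero_left)
    also have "\<dots> = (\<Sum>l\<in>K. u (x l) * g (x l) (x k))"
      using x k by (simp add: ip_comb_left)
    also have "\<dots> = (\<Sum>l\<in>K. if l = k then u (x k) * g (x k) (x k) else 0)"
      using k orth by (intro sum.cong) auto
    also have "\<dots> = u (x k) * g (x k) (x k)" using fin k by simp
    finally show False using k pos[OF k(1)] by simp
  qed
qed

text \<open>Orthogonality gives independence, and the exchange lemma gives the bound. All later
  dimension counts take this form; \<open>B\<close> may be any finite set whose span contains
  \<open>S\<close>.\<close>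

lemma orthogonal_family_card_le:
  assumes "finite K" and "\<And>k. k \<in> K \<Longrightarrow> x k \<in> S" "\<And>k. k \<in> K \<Longrightarrow> x k \<noteq> 0"
    and "\<And>k l. k \<in> K \<Longrightarrow> l \<in> K \<Longrightarrow> k \<noteq> l \<Longrightarrow> g (x k) (x l) = 0"
    and "finite B" "S \<subseteq> span B"
  shows "card K \<le> card B"
proof -
  have "inj_on x K" "independent (x ` K)"
    using orthogonal_family_independent[of K x] assms by auto
  moreover have "x ` K \<subseteq> span B" using assms by blast
  ultimately show ?thesis
    using independent_span_bound[OF \<open>finite B\<close>] by (metis card_image)
qed

lemma orthonormal_expansion:
  assumes fin: "finite K" and S: "span (e ` K) = S"
    and orth: "\<And>i j. i \<in> K \<Longrightarrow> j \<in> K \<Longrightarrow> g (e i) (e j) = (if i = j then 1 else 0)"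
    and x: "x \<in> S"
  shows "x = (\<Sum>k\<in>K. g (e k) x *\<^sub>R e k)"
proof -
  have e: "e k \<in> S" if "k \<in> K" for k using that S by (metis imageI span_base)
  have "x \<in> span (e ` K)" using x S by simp
  \<comment> \<open>Membership in \<open>S\<close> is carried through the induction because the
    linearity rules of \<open>g\<close> require it.\<close>
  then have "x \<in> S \<and> x = (\<Sum>k\<in>K. g (e k) x *\<^sub>R e k)"
  proof (induction rule: span_induct)
    case base
    show ?case
      using e by (auto simp: subspace_def ip_zero_right ip_add_right ip_scale_right scaleR_left_distrib
          sum.distrib subspace_0[OF sub] subspace_add[OF sub] subspace_scale[OF sub]
          simp flip: scaleR_scaleR scaleR_right.sum)
  next
    case (step y)
    then obtain j where j: "j \<in> K" "y = e j" by auto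
    have "(\<Sum>k\<in>K. g (e k) y *\<^sub>R e k) = (\<Sum>k\<in>K. if k = j then e j else 0)"
      using j orth by (intro sum.cong) auto
    then show ?case using j fin e by simp
  qed
  then show ?thesis by simp
qed

text \<open>If some \<open>x\<close> were missed, its difference from its orthogonal projection
  \<open>p\<close> would extend the family to \<open>n + 1\<close> nonzero orthogonal vectors, more
  than \<open>B\<close> allows.\<close>

lemma orthonormal_spans:
  assumes q: "\<And>k. k < n \<Longrightarrow> q k \<in> S"
    and orth: "\<And>i j. i < n \<Longrightarrow> j < n \<Longrightarrow> g (q i) (q j) = (if i = j then 1 else 0)"
    and B: "finite B" "S \<subseteq> span B" "card B \<le> n"
  shows "span (q ` {..<n}) = S"
proof (rule subset_antisym)
  show "span (q ` {..<n}) \<subseteq> S" using q sub by (intro span_minimal) auto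
  show "S \<subseteq> span (q ` {..<n})"
  proof (rule ccontr)
    assume "\<not> S \<subseteq> span (q ` {..<n})"
    then obtain x where x: "x \<in> S" "x \<notin> span (q ` {..<n})" by blast
    define p where "p = (\<Sum>k<n. g (q k) x *\<^sub>R q k)"
    have "p \<in> span (q ` {..<n})"
      unfolding p_def by (intro span_sum span_scale span_base) auto
    then have nz: "x - p \<noteq> 0" using x by auto
    have p: "p \<in> S" unfolding p_def using q by (intro comb_in) auto
    have qp: "g (q i) (x - p) = 0" if "i < n" for i
    proof -
      have "g (q i) p = (\<Sum>k<n. g (q k) x * g (q i) (q k))"
        unfolding p_def using q that by (intro ip_comb_right) auto
      also have "\<dots> = (\<Sum>k<n. if k = i then g (q i) x else 0)"
        using that orth by (intro sum.cong) auto
      finally show ?thesis using that x p q by (simp add: ip_diff_right)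
    qed
    have xp: "x - p \<in> S" using x p sub by (simp add: subspace_diff)
    have "card {..n} \<le> card B"
    proof (rule orthogonal_family_card_le[of _ "\<lambda>k. if k < n then q k else x - p"])
      fix k l assume kl: "k \<in> {..n}" "l \<in> {..n}" "k \<noteq> l"
      show "g (if k < n then q k else x - p) (if l < n then q l else x - p) = 0"
        using kl qp orth ip_commute[OF xp, of "q l"] q by auto
    next
      fix k assume "k \<in> {..n}"
      show "(if k < n then q k else x - p) \<noteq> 0"
        using nz orth[of k k] ip_zero_left[OF subspace_0[OF sub]] by auto
    qed (use q xp B in auto)
    then show False using B by simp
  qed
qed

end

section \<open>Central maps in coordinates\<close>

text \<open>Separates the affine coordinate from the hyperplane at infinity; applied to both source
  and target.\<close>

lemma basis_family_split:
  assumes "basis_family {0..n} b (UNIV :: 'v::real_vector set)"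
    and "basis_family {1..n} b S"
  shows "b 0 \<notin> S" and "\<exists>r. x - r *\<^sub>R b 0 \<in> S"
proof -
  have S: "span (b ` {1..n}) = S" using assms(2) by (simp add: basis_family_def)
  have ins: "{0..n} = insert 0 {1..n}" by auto
  have "b 0 \<notin> b ` {1..n}"
    using assms(1) by (fastforce simp: basis_family_def inj_on_def)
  moreover have "independent (insert (b 0) (b ` {1..n}))" and U: "span (insert (b 0) (b ` {1..n})) = UNIV"
    using assms(1) unfolding basis_family_def ins by auto
  ultimately show "b 0 \<notin> S" unfolding S[symmetric] by (simp add: independent_insert)
  show "\<exists>r. x - r *\<^sub>R b 0 \<in> S"
    using U S by (metis UNIV_I span_breakdown_eq)
qed

lemma subspace_scale_cancel: "subspace S \<Longrightarrow> t *\<^sub>R x \<in> S \<Longrightarrow> t = 0 \<or> x \<in> S"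
  using subspace_scale[of S "t *\<^sub>R x" "inverse t"] by (cases "t = 0") auto

locale central_map = I: inner_product_subspace I g + J: inner_product_subspace J g'
  for I :: "'v::real_vector set" and g :: "'v \<Rightarrow> 'v \<Rightarrow> real"
    and J :: "'w::real_vector set" and g' :: "'w \<Rightarrow> 'w \<Rightarrow> real" +
  fixes n m :: nat and f :: "'v \<Rightarrow> 'w" and b :: "nat \<Rightarrow> 'v" and c :: "nat \<Rightarrow> 'w" and A :: "real mat"
  assumes lin: "linear f" and central: "\<not> lin_kernel f \<subseteq> I" and surj: "range f = UNIV"
    and bV: "basis_family {0..n} b UNIV" and bI: "orthonormal_basis_family {1..n} b I g"
    and cW: "basis_family {0..m} c UNIV" and cJ: "orthonormal_basis_family {1..m} c J g'"
    and A: "A \<in> carrier_mat (m + 1) (n + 1)"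
    and fA: "\<forall>j\<in>{0..n}. f (b j) = (\<Sum>i=0..m. A $$ (i, j) *\<^sub>R c i)"
begin

lemma atLeast1_atMost_eq_image_Suc: "{1..k} = Suc ` {..<k}"
  by (auto simp: image_def Bex_def) presburger

text \<open>The hyperplane bases are shifted to start at index 0, matching the zero-based rows and
  columns of \<open>tilde_mat A\<close>.\<close>

lemma bI_span: "span ((\<lambda>j. b (Suc j)) ` {..<n}) = I"
  and bI_orth: "i < n \<Longrightarrow> j < n \<Longrightarrow> g (b (Suc i)) (b (Suc j)) = (if i = j then 1 else 0)"
  and cJ_span: "span ((\<lambda>j. c (Suc j)) ` {..<m}) = J"
  and cJ_orth: "i < m \<Longrightarrow> j < m \<Longrightarrow> g' (c (Suc i)) (c (Suc j)) = (if i = j then 1 else 0)"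
  using bI cJ unfolding atLeast1_atMost_eq_image_Suc by (auto simp: orthonormal_basis_family_def basis_family_def image_image)

lemma b_in: "j < n \<Longrightarrow> b (Suc j) \<in> I"
  using bI_span by (metis image_eqI lessThan_iff span_base)

lemma c_in: "i < m \<Longrightarrow> c (Suc i) \<in> J"
  using cJ_span by (metis image_eqI lessThan_iff span_base)

lemma c0: "c 0 \<notin> J"
  using basis_family_split(1)[OF cW] cJ by (simp add: orthonormal_basis_family_def)

lemma b0: "b 0 \<notin> I" "\<exists>r. x - r *\<^sub>R b 0 \<in> I"
  using basis_family_split[OF bV] bI by (simp_all add: orthonormal_basis_family_def)

lemma b_expand: "x \<in> I \<Longrightarrow> x = (\<Sum>j<n. g (b (Suc j)) x *\<^sub>R b (Suc j))"
  using bI_span bI_orth by (intro I.orthonormal_expansion) auto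

lemma c_expand: "x \<in> J \<Longrightarrow> x = (\<Sum>i<m. g' (c (Suc i)) x *\<^sub>R c (Suc i))"
  using cJ_span cJ_orth by (intro J.orthonormal_expansion) auto

text \<open>
  \<open>alpha i\<close> is the paper's \<open>a\<^sub>i\<close>, read as a vector of \<open>I\<close>. Below, \<open>tilde i\<close> is row \<open>i\<close> of
  \<open>tilde_mat A\<close> and therefore comes from \<open>a\<^bsub>i+1\<^esub>\<close>; \<open>F\<close> is the linear map with matrix \<open>tilde_mat A\<close>.
\<close>

definition alpha :: "nat \<Rightarrow> 'v" where
  "alpha i = (\<Sum>j<n. A $$ (i, Suc j) *\<^sub>R b (Suc j))"

lemma alpha_in: "alpha i \<in> I"
  unfolding alpha_def using b_in by (intro I.comb_in) auto

lemma ip_alpha: "x \<in> I \<Longrightarrow> g (alpha i) x = (\<Sum>j<n. A $$ (i, Suc j) * g (b (Suc j)) x)"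
  unfolding alpha_def using b_in by (intro I.ip_comb_left) auto

lemma ip_alpha_b:
  assumes "j < n"
  shows "g (alpha i) (b (Suc j)) = A $$ (i, Suc j)"
proof -
  have "g (alpha i) (b (Suc j)) = (\<Sum>k<n. if k = j then A $$ (i, Suc j) else 0)"
    unfolding ip_alpha[OF b_in[OF assms]] using assms by (intro sum.cong) (auto simp: bI_orth)
  then show ?thesis using assms by simp
qed

lemma f_expand:
  assumes x: "x \<in> I"
  shows "f x = g (alpha 0) x *\<^sub>R c 0 + (\<Sum>i<m. g (alpha (Suc i)) x *\<^sub>R c (Suc i))"
proof -
  have "f x = (\<Sum>j<n. g (b (Suc j)) x *\<^sub>R f (b (Suc j)))"
    by (subst b_expand[OF x]) (simp add: linear_sum[OF lin] linear_scale[OF lin])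
  also have "\<dots> = (\<Sum>j<n. \<Sum>i\<in>{0..m}. (A $$ (i, Suc j) * g (b (Suc j)) x) *\<^sub>R c i)"
    using fA by (intro sum.cong) (auto simp: scaleR_sum_right mult.commute)
  also have "\<dots> = (\<Sum>i\<in>{0..m}. g (alpha i) x *\<^sub>R c i)"
    by (subst sum.swap) (simp add: ip_alpha[OF x] scaleR_sum_left)
  finally show ?thesis
    by (simp add: sum.atLeast0_atMost_Suc_shift atLeast0AtMost lessThan_Suc_atMost[symmetric]
        sum.lessThan_Suc_shift del: sum.lessThan_Suc)
qed

text \<open>Since \<open>c 0\<close> lies outside \<open>J\<close>, only its coefficient matters.
  Thus \<open>alpha 0\<close> is a normal vector, within \<open>I\<close>, of the vectors that
  \<open>f\<close> sends into \<open>J\<close>.\<close>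

lemma f_in_J_iff:
  assumes x: "x \<in> I"
  shows "f x \<in> J \<longleftrightarrow> g (alpha 0) x = 0"
proof -
  have s: "(\<Sum>i<m. g (alpha (Suc i)) x *\<^sub>R c (Suc i)) \<in> J"
    using c_in by (intro J.comb_in) auto
  show ?thesis
  proof
    assume "f x \<in> J"
    then have "g (alpha 0) x *\<^sub>R c 0 \<in> J"
      using subspace_diff[OF J.sub _ s, of "f x"] f_expand[OF x] by simp
    then show "g (alpha 0) x = 0"
      using c0 subspace_scale_cancel[OF J.sub] by blast
  qed (use s f_expand[OF x] in simp)
qed

lemma kernel_point: "\<exists>k. f k = 0 \<and> k \<notin> I"
  using central by (auto simp: lin_kernel_def)

text \<open>Centrality enters here: a kernel vector outside \<open>I\<close> allows any preimage to
  be moved into \<open>I\<close> without changing its image.\<close>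

lemma f_onto_I: "\<exists>x\<in>I. f x = w"
proof -
  obtain y where y: "f y = w" using surj by (metis surjD)
  obtain k where k: "f k = 0" "k \<notin> I" using kernel_point by blast
  obtain r s where r: "y - r *\<^sub>R b 0 \<in> I" and s: "k - s *\<^sub>R b 0 \<in> I" using b0(2) by blast
  have "s \<noteq> 0" using s k by auto
  \<comment> \<open>The factor \<open>r / s\<close> makes the components along \<open>b 0\<close>
    cancel.\<close>
  then have "y - (r / s) *\<^sub>R k = (y - r *\<^sub>R b 0) - (r / s) *\<^sub>R (k - s *\<^sub>R b 0)"
    by (simp add: scaleR_diff_right)
  then have "y - (r / s) *\<^sub>R k \<in> I"
    using r s I.sub by (metis subspace_diff subspace_scale)
  moreover have "f (y - (r / s) *\<^sub>R k) = w"
    using y k by (simp add: linear_diff[OF lin] linear_scale[OF lin])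
  ultimately show ?thesis by blast
qed

text \<open>A preimage of \<open>c 0\<close> in \<open>I\<close> has a nonzero product with
  \<open>alpha 0\<close>. This makes the division in \<open>tilde\<close> meaningful.\<close>

lemma alpha0_pos: "0 < g (alpha 0) (alpha 0)"
proof -
  obtain x where x: "x \<in> I" "f x = c 0" using f_onto_I by blast
  then have "g (alpha 0) x \<noteq> 0" using f_in_J_iff[OF x(1)] c0 by auto
  then have "alpha 0 \<noteq> 0" using \<open>x \<in> I\<close> I.ip_zero_left by force
  then show ?thesis by (rule I.ip_pos[OF alpha_in])
qed

definition tilde :: "nat \<Rightarrow> 'v" where
  "tilde i = alpha (Suc i) - (g (alpha 0) (alpha (Suc i)) / g (alpha 0) (alpha 0)) *\<^sub>R alpha 0"

lemma tilde_in: "tilde i \<in> I"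
  unfolding tilde_def using alpha_in I.sub by (intro subspace_diff subspace_scale)

lemma ip_tilde: "x \<in> I \<Longrightarrow> g (tilde i) x = g (alpha (Suc i)) x
    - g (alpha 0) (alpha (Suc i)) / g (alpha 0) (alpha 0) * g (alpha 0) x"
  unfolding tilde_def using alpha_in by (simp add: I.ip_diff_left I.ip_scale_left subspace_scale[OF I.sub])

lemma ip_tilde_alpha0: "g (tilde i) (alpha 0) = 0"
  using alpha0_pos by (simp add: ip_tilde alpha_in I.ip_commute[OF alpha_in[of "Suc i"] alpha_in[of 0]])

definition F :: "'v \<Rightarrow> 'w" where
  "F x = (\<Sum>i<m. g (tilde i) x *\<^sub>R c (Suc i))"

lemma F_in: "F x \<in> J"
  unfolding F_def using c_in by (intro J.comb_in) auto

text \<open>The correction term in \<open>tilde\<close> vanishes on vectors orthogonal to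
  \<open>alpha 0\<close>. Together with \<open>F_alpha0\<close> this presents \<open>F\<close> as
  the extension of \<open>f\<close> from that orthogonal complement by zero along
  \<open>alpha 0\<close>.\<close>

lemma F_eq_f: "x \<in> I \<Longrightarrow> f x \<in> J \<Longrightarrow> F x = f x"
  using f_in_J_iff[of x] by (simp add: F_def f_expand[of x] ip_tilde)

lemma F_alpha0: "F (alpha 0) = 0"
  by (simp add: F_def ip_tilde_alpha0)

lemma ip_c_F:
  assumes "i < m"
  shows "g' (c (Suc i)) (F x) = g (tilde i) x"
proof -
  have "g' (c (Suc i)) (F x) = (\<Sum>k<m. if k = i then g (tilde i) x else 0)"
    unfolding F_def using assms c_in
    by (subst J.ip_comb_right) (auto simp: cJ_orth simp del: sum.delta sum.delta' intro!: sum.cong)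
  then show ?thesis using assms by simp
qed

lemma ip_F_F: "g' (F x) (F y) = (\<Sum>i<m. g (tilde i) x * g (tilde i) y)"
  unfolding F_def using c_in cJ_orth
  by (subst J.ip_comb_comb[where d = "\<lambda>_. 1"]) auto

lemma F_comb: "(\<And>k. k \<in> K \<Longrightarrow> x k \<in> I) \<Longrightarrow> F (\<Sum>k\<in>K. u k *\<^sub>R x k) = (\<Sum>k\<in>K. u k *\<^sub>R F (x k))"
  by (simp add: F_def I.ip_comb_right tilde_in scaleR_sum_left scaleR_sum_right sum.swap[of _ K])

lemma f_onto_J: "w \<in> J \<Longrightarrow> \<exists>x\<in>I. f x = w \<and> F x = w"
  using f_onto_I F_eq_f by metis

lemma row_vec_scalar_prod:
  "row_vec A 0 \<bullet> row_vec A i = g (alpha 0) (alpha i)" 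
  using A by (auto simp: row_vec_def scalar_prod_def ip_alpha[OF alpha_in] ip_alpha_b I.ip_commute[OF b_in alpha_in]
      atLeast0LessThan intro!: sum.cong)

lemma tilde_mat_carrier: "tilde_mat A \<in> carrier_mat m n"
  using A by (auto simp: tilde_mat_def)

lemma tilde_mat_entry:
  assumes "i < m" "j < n"
  shows "tilde_mat A $$ (i, j) = g (tilde i) (b (Suc j))"
proof -
  have "tilde_mat A $$ (i, j) = A $$ (Suc i, Suc j) -
      g (alpha 0) (alpha (Suc i)) / g (alpha 0) (alpha 0) * A $$ (0, Suc j)"
    unfolding tilde_mat_def using A assms
    by (simp add: mat_of_rows_index row_vec_scalar_prod del: upt_Suc) (simp add: row_vec_def)
  then show ?thesis using assms by (simp add: ip_tilde b_in ip_alpha_b)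
qed

lemma ip_b_coords:
  assumes "x \<in> I" "y \<in> I"
  shows "g x y = (\<Sum>j<n. g x (b (Suc j)) * g y (b (Suc j)))"
proof -
  have "g x y = g x (\<Sum>j<n. g (b (Suc j)) y *\<^sub>R b (Suc j))" using b_expand assms by auto
  also have "\<dots> = (\<Sum>j<n. g x (b (Suc j)) * g y (b (Suc j)))"
    using assms b_in by (subst I.ip_comb_right) (auto simp: I.ip_commute[of y] intro!: sum.cong)
  finally show ?thesis .
qed

lemma tilde_mat_gram:
  assumes "i < m" "j < m"
  shows "(tilde_mat A * (tilde_mat A)\<^sup>T) $$ (i, j) = g (tilde i) (tilde j)"
  using assms tilde_mat_carrier
  by (simp add: scalar_prod_def tilde_mat_entry ip_b_coords[OF tilde_in tilde_in] atLeast0LessThan)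

section \<open>Right singular vectors of the reduced matrix\<close>

text \<open>The rows of \<open>tilde_mat A\<close> are orthogonal to \<open>alpha 0\<close>, so its
  direction is an eigenvector of \<open>B\<^sup>T * B\<close> for the eigenvalue 0 and can be
  prescribed as the first column of the diagonalizing matrix.\<close>

lemma spectral_family:
  obtains q d where "\<And>k. k < n \<Longrightarrow> q k \<in> I"
    and "\<And>k l. k < n \<Longrightarrow> l < n \<Longrightarrow> g (q k) (q l) = (if k = l then 1 else 0)"
    and "\<And>k l. k < n \<Longrightarrow> l < n \<Longrightarrow> g' (F (q k)) (F (q l)) = (if k = l then d k else 0)"
    and "0 < n" "alpha 0 = sqrt (g (alpha 0) (alpha 0)) *\<^sub>R q 0"
    and "singular_values (tilde_mat A) = sqrt ` {d k | k. k < n \<and> d k \<noteq> 0}"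
    and "\<And>s. singular_value_multiplicity (tilde_mat A) s = card {k. k < n \<and> d k = s\<^sup>2}"
proof -
  define B where "B = tilde_mat A"
  define N where "N = sqrt (g (alpha 0) (alpha 0))"
  have N: "0 < N" "N * N = g (alpha 0) (alpha 0)" using alpha0_pos by (auto simp: N_def)
  \<comment> \<open>The coordinates of \<open>alpha 0\<close> scaled to length 1.\<close>
  define v where "v = vec n (\<lambda>j. g (alpha 0) (b (Suc j)) / N)"
  have B: "B \<in> carrier_mat m n" using tilde_mat_carrier by (simp add: B_def)
  have v: "v \<in> carrier_vec n" by (simp add: v_def)
  have "v \<bullet> v = (\<Sum>j<n. g (alpha 0) (b (Suc j)) * g (alpha 0) (b (Suc j))) / (N * N)"
    by (simp add: v_def scalar_prod_def atLeast0LessThan sum_divide_distrib)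
  also have "\<dots> = 1" using N alpha0_pos by (simp flip: ip_b_coords[OF alpha_in alpha_in])
  finally have v1: "v \<bullet> v = 1" .
  have "(B *\<^sub>v v) $ i = 0" if "i < m" for i
  proof -
    have "(B *\<^sub>v v) $ i = (\<Sum>j<n. g (tilde i) (b (Suc j)) * g (alpha 0) (b (Suc j))) / N"
      using B that by (simp add: v_def scalar_prod_def atLeast0LessThan sum_divide_distrib B_def tilde_mat_entry)
    then show ?thesis by (simp add: ip_tilde_alpha0 flip: ip_b_coords[OF tilde_in alpha_in])
  qed
  then have "B *\<^sub>v v = 0\<^sub>v m" using B by (intro eq_vecI) auto
  then have "(B\<^sup>T * B) *\<^sub>v v = 0 \<cdot>\<^sub>v v"
    using B v by (auto simp: assoc_mult_mat_vec[of _ n m _ n] intro!: eq_vecI)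
  moreover have "(B\<^sup>T * B)\<^sup>T = B\<^sup>T * B" using B by (simp add: transpose_mult[of _ n m _ n])
  moreover have "B\<^sup>T * B \<in> carrier_mat n n" using B by simp
  ultimately obtain Q d where Q: "Q \<in> carrier_mat n n" "Q\<^sup>T * Q = 1\<^sub>m n" and Q0: "col Q 0 = v"
    and D: "Q\<^sup>T * (B\<^sup>T * B) * Q = mat_diag n d"
    using symmetric_mat_diagonalize_with_eigenvector[of "B\<^sup>T * B" n v 0] v v1 by blast
  define q where "q k = (\<Sum>j<n. Q $$ (j, k) *\<^sub>R b (Suc j))" for k
  have q_in: "q k \<in> I" for k unfolding q_def using b_in by (intro I.comb_in) auto
  have "g (q k) (q l) = (Q\<^sup>T * Q) $$ (k, l)" if "k < n" "l < n" for k l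
    unfolding q_def using that Q(1) b_in bI_orth
    by (subst I.ip_comb_comb[where d = "\<lambda>_. 1"]) (auto simp: scalar_prod_def atLeast0LessThan)
  then have orth: "g (q k) (q l) = (if k = l then 1 else 0)" if "k < n" "l < n" for k l
    using that Q(2) by simp
  have BQ: "g (tilde i) (q k) = (B * Q) $$ (i, k)" if "i < m" "k < n" for i k
    unfolding q_def using that Q(1) B b_in tilde_in
    by (subst I.ip_comb_right) (auto simp: scalar_prod_def atLeast0LessThan B_def tilde_mat_entry mult.commute)
  \<comment> \<open>In this form the diagonal matrix is the Gram matrix of the images
    \<open>F (q k)\<close>, so \<open>d k\<close> is the squared length of
    \<open>F (q k)\<close>.\<close>
  have QBBQ: "Q\<^sup>T * (B\<^sup>T * B) * Q = (B * Q)\<^sup>T * (B * Q)"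
    using Q(1) B by (simp add: transpose_mult[of _ m n _ n] assoc_mult_mat[of _ n m _ n _ n]
      assoc_mult_mat[of _ n n _ m _ n] assoc_mult_mat[of _ n n _ n _ n])
  have "(C\<^sup>T * C) $$ (k, l) = (\<Sum>i<m. C $$ (i, k) * C $$ (i, l))"
    if "C \<in> carrier_mat m n" "k < n" "l < n" for C :: "real mat" and k l
    using that by (simp add: scalar_prod_def atLeast0LessThan)
  then have "g' (F (q k)) (F (q l)) = ((B * Q)\<^sup>T * (B * Q)) $$ (k, l)" if "k < n" "l < n" for k l
    using that Q(1) B by (simp add: ip_F_F BQ del: index_mult_mat(1))
  then have Forth: "g' (F (q k)) (F (q l)) = (if k = l then d k else 0)" if "k < n" "l < n" for k l
    using that D by (simp add: QBBQ mat_diag_def)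
  have n: "0 < n" using v1 v by (cases n) (auto simp: scalar_prod_def)
  have "Q $$ (j, 0) = g (alpha 0) (b (Suc j)) / N" if "j < n" for j
    using arg_cong[OF Q0, of "\<lambda>u. u $ j"] that Q(1) n by (simp add: v_def)
  then have "N *\<^sub>R q 0 = (\<Sum>j<n. g (b (Suc j)) (alpha 0) *\<^sub>R b (Suc j))"
    using N by (auto simp: q_def scaleR_sum_right I.ip_commute[OF b_in alpha_in] intro!: sum.cong)
  then have "alpha 0 = N *\<^sub>R q 0" using b_expand[OF alpha_in, of 0] by simp
  then show thesis
    using that[OF q_in orth Forth n] singular_values_diagonalized[OF B Q D]
    unfolding B_def N_def by blast
qed

section \<open>Similarities and subspaces of the hyperplane at infinity\<close>

lemma similarity_collineationD:
  assumes T: "complementary T (lin_kernel f)" and sim: "collineation_is_similarity I g J g' f T"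
  obtains r where "0 < r" "f ` (T \<inter> I) = J"
    "\<And>x y. x \<in> T \<inter> I \<Longrightarrow> y \<in> T \<inter> I \<Longrightarrow> g' (f x) (f y) = r\<^sup>2 * g x y"
proof -
  obtain r h where r: "0 < r" and h: "linear_isometry_on (T \<inter> I) g J g' h"
    and fh: "\<forall>x\<in>T \<inter> I. f x = r *\<^sub>R h x" and im: "f ` (T \<inter> I) = J"
    using sim unfolding collineation_is_similarity_def by blast
  have "g' (f x) (f y) = r\<^sup>2 * g x y" if "x \<in> T \<inter> I" "y \<in> T \<inter> I" for x y
    using that fh h by (auto simp: linear_isometry_on_def J.ip_scale_left J.ip_scale_right
        subspace_scale[OF J.sub] power2_eq_square)
  then show thesis using that r im by blast
qed

text \<open>One vector \<open>p\<close> outside \<open>I\<close> with image \<open>c 0\<close> is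
  adjoined to \<open>S\<close>. As \<open>p\<close> is not in \<open>I\<close>, nothing new appears
  at infinity; as \<open>c 0\<close> is not in \<open>J\<close> and \<open>f\<close> is injective on
  \<open>S\<close>, the span meets the kernel trivially.\<close>

lemma similarity_collineationI:
  assumes S: "subspace S" "S \<subseteq> I" and im: "f ` S = J" and r: "0 < r"
    and sc: "\<And>x y. x \<in> S \<Longrightarrow> y \<in> S \<Longrightarrow> g' (f x) (f y) = r\<^sup>2 * g x y"
  obtains T where "complementary T (lin_kernel f)" "collineation_is_similarity I g J g' f T" "T \<inter> I = S"
proof -
  obtain x0 where x0: "x0 \<in> I" "f x0 = c 0" using f_onto_I by blast
  obtain k where k: "f k = 0" "k \<notin> I" using kernel_point by blast
  \<comment> \<open>Adding the kernel vector \<open>k\<close> moves \<open>x0\<close> out of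
    \<open>I\<close> and leaves its image unchanged.\<close>
  define p where "p = x0 + k"
  have fp: "f p = c 0" using x0 k by (simp add: p_def linear_add[OF lin])
  have p: "p \<notin> I" using x0 k I.sub unfolding p_def by (metis add_diff_cancel_left' subspace_diff)
  define T where "T = span (insert p S)"
  have T: "x \<in> T \<longleftrightarrow> (\<exists>t. x - t *\<^sub>R p \<in> S)" for x
    by (simp add: T_def span_breakdown_eq span_eq_iff[THEN iffD2, OF S(1)])
  have TI: "T \<inter> I = S"
  proof
    show "T \<inter> I \<subseteq> S"
    proof
      fix x assume x: "x \<in> T \<inter> I"
      then obtain t where t: "x - t *\<^sub>R p \<in> S" using T by blast
      then have "x - (x - t *\<^sub>R p) \<in> I" using x S(2) I.sub by (blast intro: subspace_diff)
      then have "t = 0" using p subspace_scale_cancel[OF I.sub, of t p] by simp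
      then show "x \<in> S" using t by simp
    qed
    show "S \<subseteq> T \<inter> I" using S(2) by (auto simp: T_def intro: span_base)
  qed
  have inj: "x = 0" if "x \<in> S" "f x = 0" for x
    using sc[OF that(1,1)] that r S(2) I.ip_eq_zero[of x] J.ip_zero_left[OF subspace_0[OF J.sub]] by auto
  have "T \<inter> lin_kernel f = {0}"
  proof -
    have "x = 0" if x: "x \<in> T" "f x = 0" for x
    proof -
      obtain t where t: "x - t *\<^sub>R p \<in> S" using T x by blast
      then have "f (x - t *\<^sub>R p) \<in> J" using im by blast
      then have "- t *\<^sub>R c 0 \<in> J" using x fp by (simp add: linear_diff[OF lin] linear_scale[OF lin])
      then have "t = 0" using c0 subspace_scale_cancel[OF J.sub, of "- t" "c 0"] by simp
      then show ?thesis using t x inj by simp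
    qed
    then show ?thesis
      by (auto simp: lin_kernel_def T_def span_zero linear_0[OF lin])
  qed
  moreover have "\<exists>t k. x = t + k \<and> t \<in> T \<and> k \<in> lin_kernel f" for x
  proof -
    have "\<exists>r. f x - r *\<^sub>R c 0 \<in> J"
      using basis_family_split(2)[OF cW] cJ by (simp add: orthonormal_basis_family_def)
    \<comment> \<open>After removal of its \<open>c 0\<close> component, \<open>f x\<close> lies in
      \<open>J\<close> and so has a preimage in \<open>S\<close>.\<close>
    then obtain a s where s: "s \<in> S" "f x - a *\<^sub>R c 0 = f s" using im by (metis imageE)
    have "s + a *\<^sub>R p \<in> T" unfolding T using s(1) by (intro exI[of _ a]) simp
    moreover have "x - (s + a *\<^sub>R p) \<in> lin_kernel f"
      using s(2) fp by (simp add: lin_kernel_def linear_diff[OF lin] linear_add[OF lin] linear_scale[OF lin] algebra_simps)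
    ultimately show ?thesis
      by (intro exI[of _ "s + a *\<^sub>R p"] exI[of _ "x - (s + a *\<^sub>R p)"]) simp
  qed
  ultimately have "complementary T (lin_kernel f)"
    unfolding complementary_def using subspace_lin_kernel[OF lin] by (auto simp: T_def)
  moreover have "linear_isometry_on S g J g' (\<lambda>x. (1 / r) *\<^sub>R f x)"
  proof -
    have fJ: "f x \<in> J" if "x \<in> S" for x using that im by blast
    show ?thesis
      unfolding linear_isometry_on_def
      using r fJ sc by (auto simp: linear_add[OF lin] linear_scale[OF lin] scaleR_add_right
          J.ip_scale_left J.ip_scale_right subspace_scale[OF J.sub] power2_eq_square)
  qed
  moreover have "p \<in> T" by (simp add: T_def span_base)
  ultimately have "collineation_is_similarity I g J g' f T"
    unfolding collineation_is_similarity_def TI using im r p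
    by (intro conjI exI[of _ r] exI[of _ "\<lambda>x. (1 / r) *\<^sub>R f x"]) auto
  with \<open>complementary T (lin_kernel f)\<close> show thesis using that TI by blast
qed

end

lemma span_finite_family:
  assumes "finite K" and "y \<in> span (x ` K)"
  shows "\<exists>u. y = (\<Sum>k\<in>K. u k *\<^sub>R x k)"
  using assms(2)
proof (induction rule: span_induct)
  case base
  have "\<exists>w. (\<Sum>k\<in>K. u k *\<^sub>R x k) + (\<Sum>k\<in>K. v k *\<^sub>R x k) = (\<Sum>k\<in>K. w k *\<^sub>R x k)" for u v
    by (intro exI[of _ "\<lambda>k. u k + v k"]) (simp add: scaleR_left_distrib sum.distrib)
  moreover have "\<exists>w. t *\<^sub>R (\<Sum>k\<in>K. u k *\<^sub>R x k) = (\<Sum>k\<in>K. w k *\<^sub>R x k)" for t u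
    by (intro exI[of _ "\<lambda>k. t * u k"]) (simp add: scaleR_sum_right)
  moreover have "\<exists>w. 0 = (\<Sum>k\<in>K. w k *\<^sub>R x k)"
    by (intro exI[of _ "\<lambda>_. 0"]) simp
  ultimately show ?case unfolding subspace_def mem_Collect_eq by blast
next
  case (step y)
  then obtain j where "j \<in> K" "y = x j" by auto
  then show ?case
    using assms(1) by (intro exI[of _ "\<lambda>k. if k = j then 1 else 0"])
      (simp add: if_distrib[of "\<lambda>t. t *\<^sub>R _"] cong: if_cong)
qed

context central_map
begin

text \<open>Bilinearity extends the scale condition from the family to its span, which becomes the
  part of \<open>T\<close> at infinity. Both constructions of a similarity use this.\<close>

lemma similarity_from_orthogonal_family:
  assumes K: "finite K" and x: "\<And>k. k \<in> K \<Longrightarrow> x k \<in> I"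
    and fx: "\<And>k. k \<in> K \<Longrightarrow> f (x k) \<in> J" and J: "J \<subseteq> span ((\<lambda>k. f (x k)) ` K)"
    and orth: "\<And>k l. k \<in> K \<Longrightarrow> l \<in> K \<Longrightarrow> g (x k) (x l) = (if k = l then d k else 0)"
    and forth: "\<And>k l. k \<in> K \<Longrightarrow> l \<in> K \<Longrightarrow> g' (f (x k)) (f (x l)) = (if k = l then r\<^sup>2 * d k else 0)"
    and r: "0 < r"
  obtains T where "complementary T (lin_kernel f)" "collineation_is_similarity I g J g' f T"
    "T \<inter> I = span (x ` K)"
proof (rule similarity_collineationI[of "span (x ` K)" r])
  show "span (x ` K) \<subseteq> I" using x I.sub by (intro span_minimal) auto
  have "f ` span (x ` K) = span ((\<lambda>k. f (x k)) ` K)"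
    using linear_span_image[OF lin, of "x ` K"] by (simp add: image_image)
  moreover have "span ((\<lambda>k. f (x k)) ` K) \<subseteq> J" using fx J.sub by (intro span_minimal) auto
  ultimately show "f ` span (x ` K) = J" using J by simp
  fix y z assume "y \<in> span (x ` K)" "z \<in> span (x ` K)"
  then obtain u v where y: "y = (\<Sum>k\<in>K. u k *\<^sub>R x k)" and z: "z = (\<Sum>k\<in>K. v k *\<^sub>R x k)"
    using span_finite_family[OF K] by metis
  have "g' (f y) (f z) = (\<Sum>k\<in>K. u k * v k * (r\<^sup>2 * d k))"
    unfolding y z using fx K forth
    by (simp add: linear_sum[OF lin] linear_scale[OF lin] J.ip_comb_comb[where d = "\<lambda>k. r\<^sup>2 * d k"])
  moreover have "g y z = (\<Sum>k\<in>K. u k * v k * d k)"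
    unfolding y z using x K orth by (intro I.ip_comb_comb) auto
  ultimately show "g' (f y) (f z) = r\<^sup>2 * g y z"
    by (simp add: sum_distrib_left mult_ac)
qed (use r that in auto)

section \<open>Orthogonal central projections\<close>

lemma tilde_kernel_orth: "z \<in> I \<Longrightarrow> f z = 0 \<Longrightarrow> i < m \<Longrightarrow> g (tilde i) z = 0"
  using ip_c_F[of i z] F_eq_f[of z] subspace_0[OF J.sub] J.ip_zero_right[OF c_in] by simp

lemma tilde_mat_gram_eq_iff:
  "tilde_mat A * (tilde_mat A)\<^sup>T = mat_diag m (\<lambda>_. v) \<longleftrightarrow>
    (\<forall>i<m. \<forall>j<m. g (tilde i) (tilde j) = (if i = j then v else 0))"
proof -
  have "tilde_mat A * (tilde_mat A)\<^sup>T \<in> carrier_mat m m" using tilde_mat_carrier by simp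
  then show ?thesis by (auto simp: mat_eq_iff tilde_mat_gram mat_diag_def simp del: index_mult_mat(1))
qed

text \<open>The preimages \<open>x i\<close> of the basis of \<open>J\<close> in
  \<open>T \<inter> I\<close> are orthogonal with squared length \<open>1 / r\<^sup>2\<close>. Both
  \<open>tilde i\<close> and \<open>r\<^sup>2 *\<^sub>R x i\<close> are orthogonal to
  \<open>alpha 0\<close> and to the kernel within \<open>I\<close>, and they have equal products
  with every \<open>x j\<close>; so they coincide.\<close>

lemma orthogonal_similarity_imp_tilde_orthogonal:
  assumes T: "complementary T (lin_kernel f)" and orth: "projection_is_orthogonal_central I g f T"
    and sim: "collineation_is_similarity I g J g' f T"
  shows "\<exists>v>0. \<forall>i<m. \<forall>j<m. g (tilde i) (tilde j) = (if i = j then v else 0)"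
proof -
  obtain r where r: "0 < r" and im: "f ` (T \<inter> I) = J"
    and sc: "\<And>x y. x \<in> T \<inter> I \<Longrightarrow> y \<in> T \<inter> I \<Longrightarrow> g' (f x) (f y) = r\<^sup>2 * g x y"
    using similarity_collineationD[OF T sim] by blast
  have S: "f x \<in> J" "g (alpha 0) x = 0" "F x = f x" if "x \<in> T \<inter> I" for x
  proof -
    show fJ: "f x \<in> J" using im that by blast
    show "g (alpha 0) x = 0" using that fJ f_in_J_iff[of x] by simp
    show "F x = f x" using that fJ F_eq_f by simp
  qed
  \<comment> \<open>This rules out one of the two orthogonality alternatives: \<open>alpha 0\<close>
    is orthogonal to \<open>T \<inter> I\<close> but not in the kernel.\<close>
  have "alpha 0 \<in> orth_compl I g (T \<inter> I)" using S(2) alpha_in by (auto simp: orth_compl_def)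
  moreover have "f (alpha 0) \<noteq> 0"
    using f_in_J_iff[OF alpha_in, of 0] alpha0_pos subspace_0[OF J.sub] by auto
  ultimately have KS: "lin_kernel f \<inter> I \<subseteq> orth_compl I g (T \<inter> I)"
    using orth by (auto simp: projection_is_orthogonal_central_def lin_kernel_def)
  have "\<exists>x\<in>T \<inter> I. f x = c (Suc i)" if "i < m" for i
    using im c_in[OF that] by (metis imageE)
  then obtain x where x: "\<And>i. i < m \<Longrightarrow> x i \<in> T \<inter> I" and fx: "\<And>i. i < m \<Longrightarrow> f (x i) = c (Suc i)"
    by metis
  have gx: "g (x i) (x j) = (if i = j then 1 / r\<^sup>2 else 0)" if "i < m" "j < m" for i j
    using sc[OF x x, OF that] cJ_orth[OF that] that fx r by (auto simp: field_simps split: if_splits)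
  have tx: "g (tilde i) (x j) = (if i = j then 1 else 0)" if "i < m" "j < m" for i j
    using ip_c_F[OF that(1), of "x j"] S(3)[OF x[OF that(2)]] fx cJ_orth that by simp
  have "tilde i = r\<^sup>2 *\<^sub>R x i" if i: "i < m" for i
  proof -
    define w where "w = tilde i - r\<^sup>2 *\<^sub>R x i"
    have xI: "x j \<in> I" if "j < m" for j using x that by auto
    have rx: "r\<^sup>2 *\<^sub>R x i \<in> I" using xI[OF i] subspace_scale[OF I.sub] by blast
    have w: "w \<in> I" unfolding w_def using tilde_in rx I.sub by (intro subspace_diff)
    have wx: "g w (x j) = 0" if "j < m" for j
      using that i r tx gx xI unfolding w_def
      by (simp add: I.ip_diff_left[OF tilde_in rx] I.ip_scale_left)
    have wz: "g w z = 0" if z: "z \<in> I" "f z = 0" for z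
    proof -
      have "g (x i) z = 0"
        using KS z x[OF i] xI[OF i] I.ip_commute[of "x i" z] by (auto simp: lin_kernel_def orth_compl_def)
      then show ?thesis
        using z i xI[OF i] unfolding w_def
        by (simp add: I.ip_diff_left[OF tilde_in rx] I.ip_scale_left tilde_kernel_orth)
    qed
    have "g (alpha 0) w = 0"
      unfolding w_def using S(2)[OF x[OF i]] xI[OF i]
      by (simp add: I.ip_diff_right[OF alpha_in tilde_in rx] I.ip_scale_right alpha_in
          I.ip_commute[OF alpha_in tilde_in] ip_tilde_alpha0)
    then have fw: "f w \<in> J" using f_in_J_iff[OF w] by simp
    \<comment> \<open>The combination of the \<open>x j\<close> with the same image as
      \<open>w\<close>. Then \<open>w\<close> is orthogonal to \<open>p\<close> and to the kernel
      vector \<open>w - p\<close>, hence to itself.\<close>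
    define p where "p = (\<Sum>j<m. g' (c (Suc j)) (f w) *\<^sub>R x j)"
    have p: "p \<in> I" unfolding p_def using xI by (intro I.comb_in) auto
    have "f p = f w"
      using c_expand[OF fw] fx by (simp add: p_def linear_sum[OF lin] linear_scale[OF lin])
    then have "g w (w - p) = 0"
      using w p I.sub by (intro wz) (simp_all add: linear_diff[OF lin] subspace_diff)
    moreover have "g w p = 0"
      unfolding p_def using xI w wx by (subst I.ip_comb_right) auto
    ultimately have "g w w = 0" using w p by (simp add: I.ip_diff_right)
    then show ?thesis using I.ip_eq_zero[OF w] by (simp add: w_def)
  qed
  note tilde_x = this
  have "g (tilde i) (tilde j) = (if i = j then r\<^sup>2 else 0)" if "i < m" "j < m" for i j
  proof -
    have "g (tilde i) (tilde j) = g (tilde i) (r\<^sup>2 *\<^sub>R x j)" using tilde_x[OF that(2)] by simp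
    also have "\<dots> = r\<^sup>2 * g (tilde i) (x j)"
      using x[OF that(2)] by (intro I.ip_scale_right tilde_in) auto
    finally show ?thesis using tx[OF that] by simp
  qed
  then show ?thesis using r by (intro exI[of _ "r\<^sup>2"]) simp
qed

text \<open>The rows themselves span the required subspace: \<open>f\<close> sends
  \<open>tilde i\<close>, of squared length \<open>v\<close>, to
  \<open>v *\<^sub>R c (Suc i)\<close>, so the scale factor is \<open>sqrt v\<close>. The kernel
  within \<open>I\<close> is orthogonal to all rows.\<close>

lemma tilde_orthogonal_imp_orthogonal_similarity:
  assumes v: "0 < v" and orth: "\<forall>i<m. \<forall>j<m. g (tilde i) (tilde j) = (if i = j then v else 0)"
  shows "orthogonal_central_projection_then_similarity I g J g' f"
proof -
  have "f (tilde i) \<in> J" for i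
    using f_in_J_iff[OF tilde_in] ip_tilde_alpha0 I.ip_commute[OF alpha_in tilde_in] by metis
  then have ft: "f (tilde i) = F (tilde i)" for i using F_eq_f[OF tilde_in] by simp
  have Ft: "F (tilde i) = v *\<^sub>R c (Suc i)" if "i < m" for i
  proof -
    have "F (tilde i) = (\<Sum>k<m. if k = i then v *\<^sub>R c (Suc i) else 0)"
      unfolding F_def using that orth by (intro sum.cong) auto
    then show ?thesis using that by simp
  qed
  obtain T where T: "complementary T (lin_kernel f)" and sim: "collineation_is_similarity I g J g' f T"
    and TI: "T \<inter> I = span (tilde ` {..<m})"
  proof (rule similarity_from_orthogonal_family[of "{..<m}" tilde "\<lambda>_. v" "sqrt v"])
    show "J \<subseteq> span ((\<lambda>k. f (tilde k)) ` {..<m})"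
    proof
      fix w assume w: "w \<in> J"
      have "c (Suc i) \<in> span ((\<lambda>k. f (tilde k)) ` {..<m})" if "i < m" for i
      proof -
        have "c (Suc i) = (1 / v) *\<^sub>R f (tilde i)" using v that ft Ft by simp
        then show ?thesis using that by (metis imageI lessThan_iff span_base span_scale)
      qed
      then have "(\<Sum>i<m. g' (c (Suc i)) w *\<^sub>R c (Suc i)) \<in> span ((\<lambda>k. f (tilde k)) ` {..<m})"
        by (intro span_sum span_scale) auto
      then show "w \<in> span ((\<lambda>k. f (tilde k)) ` {..<m})" using c_expand[OF w] by simp
    qed
    show "g' (f (tilde k)) (f (tilde l)) = (if k = l then (sqrt v)\<^sup>2 * v else 0)"
      if "k \<in> {..<m}" "l \<in> {..<m}" for k l
      using that v by (simp add: ft Ft J.ip_scale_left J.ip_scale_right c_in cJ_orth subspace_scale[OF J.sub])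
  qed (use tilde_in orth v ft F_in in auto)
  have "lin_kernel f \<inter> I \<subseteq> orth_compl I g (T \<inter> I)"
  proof
    fix z assume "z \<in> lin_kernel f \<inter> I"
    then have z: "z \<in> I" "f z = 0" by (auto simp: lin_kernel_def)
    have "g z y = 0" if y: "y \<in> T \<inter> I" for y
    proof -
      obtain u where "y = (\<Sum>k<m. u k *\<^sub>R tilde k)"
        using y span_finite_family[of "{..<m}" y tilde] unfolding TI by blast
      then show ?thesis
        using z tilde_in by (simp add: I.ip_comb_right I.ip_commute[of z] tilde_kernel_orth)
    qed
    then show "z \<in> orth_compl I g (T \<inter> I)" using z by (simp add: orth_compl_def)
  qed
  then have "projection_is_orthogonal_central I g f T"
    using sim by (simp add: projection_is_orthogonal_central_def collineation_is_similarity_def)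
  then show ?thesis
    using T sim by (auto simp: orthogonal_central_projection_then_similarity_def)
qed

lemma orthogonal_similarity_iff:
  "orthogonal_central_projection_then_similarity I g J g' f \<longleftrightarrow>
    (\<exists>v>0. tilde_mat A * (tilde_mat A)\<^sup>T = mat_diag m (\<lambda>_. v))"
  unfolding tilde_mat_gram_eq_iff
  using orthogonal_similarity_imp_tilde_orthogonal tilde_orthogonal_imp_orthogonal_similarity
  by (metis orthogonal_central_projection_then_similarity_def)

end

section \<open>Multiplicity of the least singular value\<close>

text \<open>
  \<open>q\<close> is a basis of right singular vectors of \<open>tilde_mat A\<close>, \<open>d k\<close> is the squared singular value of
  \<open>q k\<close>, and \<open>E\<close> collects the indices with nonzero \<open>d k\<close>. Index \<open>0\<close> is reserved for the
  direction of \<open>alpha 0\<close>.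
\<close>

locale singular_basis = central_map I g J g' n m f b c A
  for I :: "'v::real_vector set" and g :: "'v \<Rightarrow> 'v \<Rightarrow> real"
    and J :: "'w::real_vector set" and g' :: "'w \<Rightarrow> 'w \<Rightarrow> real"
    and n m :: nat and f :: "'v \<Rightarrow> 'w" and b :: "nat \<Rightarrow> 'v" and c :: "nat \<Rightarrow> 'w" and A :: "real mat" +
  fixes q :: "nat \<Rightarrow> 'v" and d :: "nat \<Rightarrow> real" and E :: "nat set"
  assumes finE: "finite E" and E_sub: "E \<subseteq> {0<..<n}" and n_pos: "0 < n" and card_E: "card E = m"
    and q: "\<And>k. k < n \<Longrightarrow> q k \<in> I"
    and orth: "\<And>k l. k < n \<Longrightarrow> l < n \<Longrightarrow> g (q k) (q l) = (if k = l then 1 else 0)"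
    and fq: "\<And>k. 0 < k \<Longrightarrow> k < n \<Longrightarrow> f (q k) \<in> J"
    and dpos: "\<And>k. k \<in> E \<Longrightarrow> 0 < d k"
    and fz: "\<And>k. 0 < k \<Longrightarrow> k < n \<Longrightarrow> k \<notin> E \<Longrightarrow> f (q k) = 0"
    and forth: "\<And>k l. k \<in> E \<Longrightarrow> l \<in> E \<Longrightarrow> g' (f (q k)) (f (q l)) = (if k = l then d k else 0)"
    and Jspan: "J \<subseteq> span ((\<lambda>k. f (q k)) ` E)"
    and ker: "\<And>l z. l \<in> insert 0 E \<Longrightarrow> z \<in> I \<Longrightarrow> f z = 0 \<Longrightarrow> g (q l) z = 0"
    and sv: "singular_values (tilde_mat A) = sqrt ` d ` E"
    and mult: "\<And>s. s \<noteq> 0 \<Longrightarrow> singular_value_multiplicity (tilde_mat A) s = card {k\<in>E. d k = s\<^sup>2}"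

text \<open>The nonzero \<open>F (q k)\<close> are orthogonal and span \<open>J\<close>, because
  \<open>f\<close> already maps \<open>I\<close> onto a set containing \<open>J\<close>.
  Independence and spanning give the two inequalities for \<open>card E = m\<close>.\<close>

lemma (in central_map) singular_basis_exists: "\<exists>q d E. singular_basis I g J g' n m f b c A q d E"
proof -
  obtain q d where q: "\<And>k. k < n \<Longrightarrow> q k \<in> I"
    and orth: "\<And>k l. k < n \<Longrightarrow> l < n \<Longrightarrow> g (q k) (q l) = (if k = l then 1 else 0)"
    and Forth: "\<And>k l. k < n \<Longrightarrow> l < n \<Longrightarrow> g' (F (q k)) (F (q l)) = (if k = l then d k else 0)"
    and n: "0 < n" and a0: "alpha 0 = sqrt (g (alpha 0) (alpha 0)) *\<^sub>R q 0"
    and sv: "singular_values (tilde_mat A) = sqrt ` {d k | k. k < n \<and> d k \<noteq> 0}"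
    and mult: "\<And>s. singular_value_multiplicity (tilde_mat A) s = card {k. k < n \<and> d k = s\<^sup>2}"
    using spectral_family by blast
  define N where "N = sqrt (g (alpha 0) (alpha 0))"
  have N: "0 < N" using alpha0_pos by (simp add: N_def)
  have a0: "alpha 0 = N *\<^sub>R q 0" using a0 by (simp add: N_def)
  have ip_a0: "g (alpha 0) z = N * g (q 0) z" if "z \<in> I" for z
    unfolding a0 using that q n by (intro I.ip_scale_left) auto
  define E where "E = {k. k < n \<and> d k \<noteq> 0}"
  have "F (alpha 0) = N *\<^sub>R F (q 0)"
    using F_comb[of "{0::nat}" q "\<lambda>_. N"] q n by (simp add: a0)
  then have "F (q 0) = 0" using F_alpha0 N by simp
  then have d0: "d 0 = 0" using Forth[of 0 0] n J.ip_zero_left[OF subspace_0[OF J.sub]] by simp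
  have E: "finite E" "E \<subseteq> {0<..<n}"
    using d0 by (auto simp: E_def intro: gr0I)
  \<comment> \<open>For positive \<open>k\<close>, \<open>q k\<close> is orthogonal to
    \<open>q 0\<close>, the direction of \<open>alpha 0\<close>.\<close>
  have fq: "f (q k) \<in> J" if "0 < k" "k < n" for k
    using that f_in_J_iff[OF q] ip_a0[OF q] orth n by simp
  then have Fq: "F (q k) = f (q k)" if "0 < k" "k < n" for k
    using that F_eq_f[OF q] by blast
  have dpos: "0 < d k" if "k \<in> E" for k
    using that J.ip_nonneg[OF F_in, of "q k"] Forth[of k k] by (auto simp: E_def)
  have Fz: "F (q k) = 0" if "k < n" "k \<notin> E" for k
    using that J.ip_eq_zero[OF F_in, of "q k"] Forth[of k k] by (auto simp: E_def)
  have qspan: "span (q ` {..<n}) = I"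
  proof (rule I.orthonormal_spans[OF q orth])
    show "card ((\<lambda>j. b (Suc j)) ` {..<n}) \<le> n" using card_image_le[of "{..<n}"] by simp
  qed (use bI_span in auto)
  have Fexp: "F z = (\<Sum>k<n. g (q k) z *\<^sub>R F (q k))" if "z \<in> I" for z
  proof -
    have "z = (\<Sum>k<n. g (q k) z *\<^sub>R q k)"
      using that qspan orth by (intro I.orthonormal_expansion) auto
    then show ?thesis using F_comb[of "{..<n}" q "\<lambda>k. g (q k) z"] q by simp
  qed
  have Jspan: "J \<subseteq> span ((\<lambda>k. F (q k)) ` E)"
  proof
    fix w assume "w \<in> J"
    then obtain x where x: "x \<in> I" "F x = w" using f_onto_J by blast
    have "F (q k) \<in> span ((\<lambda>k. F (q k)) ` E)" if "k < n" for k
      using Fz[OF that] by (cases "k \<in> E") (auto intro: span_base span_zero)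
    then show "w \<in> span ((\<lambda>k. F (q k)) ` E)"
      unfolding x(2)[symmetric] Fexp[OF x(1)] by (intro span_sum span_scale) auto
  qed
  have E_bounds: "k < n" if "k \<in> E" for k using that by (simp add: E_def)
  have "card E \<le> card ((\<lambda>j. c (Suc j)) ` {..<m})"
  proof (rule J.orthogonal_family_card_le[of _ "\<lambda>k. F (q k)"])
    show "F (q k) \<noteq> 0" if "k \<in> E" for k
      using that dpos[OF that] Forth[OF E_bounds E_bounds, OF that that] J.ip_zero_left[OF subspace_0[OF J.sub]] by auto
  qed (use E F_in Forth E_bounds cJ_span in auto)
  also have "\<dots> \<le> m" using card_image_le[of "{..<m}"] by simp
  finally have "card E \<le> m" .
  moreover have "card {..<m} \<le> card ((\<lambda>k. F (q k)) ` E)"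
  proof (rule J.orthogonal_family_card_le[of _ "\<lambda>j. c (Suc j)"])
    show "c (Suc k) \<noteq> 0" if "k \<in> {..<m}" for k
      using that cJ_orth[of k k] J.ip_zero_left[OF subspace_0[OF J.sub]] by auto
  qed (use E c_in cJ_orth Jspan in auto)
  then have "m \<le> card E" using card_image_le[OF E(1)] by (metis card_lessThan le_trans)
  ultimately have card: "card E = m" by simp
  have ker: "g (q l) z = 0" if l: "l \<in> insert 0 E" and z: "z \<in> I" "f z = 0" for l z
  proof -
    have fz: "f z \<in> J" using z subspace_0[OF J.sub] by simp
    show ?thesis
    proof (cases "l = 0")
      case True
      then show ?thesis using f_in_J_iff[OF z(1)] fz ip_a0[OF z(1)] N by simp
    next
      case False
      then have lE: "l \<in> E" using l by simp
      \<comment> \<open>Pairing with \<open>F (q l)\<close> isolates the coefficient of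
        \<open>z\<close> along \<open>q l\<close>, multiplied by \<open>d l\<close>, which is
        positive.\<close>
      have "0 = g' (F (q l)) (F z)"
        using z F_eq_f[OF z(1) fz] J.ip_zero_right[OF F_in] by simp
      also have "\<dots> = (\<Sum>k<n. g (q k) z * g' (F (q l)) (F (q k)))"
        unfolding Fexp[OF z(1)] using F_in by (intro J.ip_comb_right) auto
      also have "\<dots> = (\<Sum>k<n. if k = l then g (q l) z * d l else 0)"
        using Forth E_bounds[OF lE] by (intro sum.cong) auto
      also have "\<dots> = g (q l) z * d l" using E_bounds[OF lE] by simp
      finally show ?thesis using dpos[OF lE] by simp
    qed
  qed
  have E0: "0 < k" if "k \<in> E" for k using that E by auto
  have "singular_basis I g J g' n m f b c A q d E"
  proof (unfold_locales; (fact E n card q orth fq dpos ker)?)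
    show "f (q k) = 0" if "0 < k" "k < n" "k \<notin> E" for k using Fq[OF that(1,2)] Fz[OF that(2,3)] by simp
    show "g' (f (q k)) (f (q l)) = (if k = l then d k else 0)" if "k \<in> E" "l \<in> E" for k l
      using Forth[OF E_bounds E_bounds, OF that] Fq E0 E_bounds that by simp
    have "(\<lambda>k. f (q k)) ` E = (\<lambda>k. F (q k)) ` E"
      by (rule image_cong) (simp_all add: Fq E0 E_bounds)
    then show "J \<subseteq> span ((\<lambda>k. f (q k)) ` E)" using Jspan by simp
    show "singular_values (tilde_mat A) = sqrt ` d ` E"
      unfolding sv E_def by (rule arg_cong[where f = "image sqrt"]) auto
    \<comment> \<open>For nonzero \<open>s\<close>, any index with \<open>d k = s\<^sup>2\<close>
      lies in \<open>E\<close>.\<close>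
    show "singular_value_multiplicity (tilde_mat A) s = card {k\<in>E. d k = s\<^sup>2}" if "s \<noteq> 0" for s
      unfolding mult E_def using that by (intro arg_cong[where f = card]) auto
  qed
  then show ?thesis by blast
qed

context singular_basis
begin

lemmas E = finE E_sub n_pos card_E

lemma E_bounds: "k \<in> E \<Longrightarrow> 0 < k" "k \<in> E \<Longrightarrow> k < n"
  using E_sub by auto

text \<open>With \<open>P\<close> the indices where \<open>d k\<close> differs from
  \<open>r\<^sup>2\<close>, a count of orthogonal vectors gives
  \<open>m + 1 + card P \<le> n\<close>. Unless \<open>P = E\<close>, \<open>r\<close> is the least
  singular value and its multiplicity is \<open>m - card P\<close>.\<close>

lemma similarity_imp_multiplicity:
  assumes T: "complementary T (lin_kernel f)"
    and sim: "collineation_is_similarity I g J g' f T"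
  shows "int (singular_value_multiplicity (tilde_mat A) (Min (singular_values (tilde_mat A))))
    \<ge> 2 * int m - int n + 1"
proof -
  obtain r where r: "0 < r" and im: "f ` (T \<inter> I) = J"
    and sc: "\<And>x y. x \<in> T \<inter> I \<Longrightarrow> y \<in> T \<inter> I \<Longrightarrow> g' (f x) (f y) = r\<^sup>2 * g x y"
    using similarity_collineationD[OF T sim] by blast
  have "\<exists>x\<in>T \<inter> I. f x = f (q k)" if "k \<in> E" for k
    using im fq[OF E_bounds, OF that that] by (metis imageE)
  then obtain x where x: "\<And>k. k \<in> E \<Longrightarrow> x k \<in> T \<inter> I" and fx: "\<And>k. k \<in> E \<Longrightarrow> f (x k) = f (q k)"
    by metis
  define y where "y k = x k - q k" for k
  have y: "y k \<in> I" "f (y k) = 0" if "k \<in> E" for k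
    using that x fx q E_bounds I.sub unfolding y_def by (auto simp: linear_diff[OF lin] intro!: subspace_diff)
  have qy: "g (q l) (y k) = 0" if "k \<in> E" "l \<in> insert 0 E" for k l
    using ker that y by blast
  have yy: "g (y k) (y l) = (if k = l then d k / r\<^sup>2 - 1 else 0)" if kl: "k \<in> E" "l \<in> E" for k l
  proof -
    have qk: "q k \<in> I" and ql: "q l \<in> I" using q E_bounds kl by auto
    have xk: "x k = q k + y k" "x l = q l + y l" by (simp_all add: y_def)
    have "(if k = l then d k else 0) = r\<^sup>2 * g (x k) (x l)"
      using sc[OF x x, OF kl] fx kl forth by simp
    \<comment> \<open>The cross terms vanish because \<open>q k\<close> with
      \<open>k \<in> E\<close> is orthogonal to the kernel within \<open>I\<close>.\<close>
    also have "g (x k) (x l) = g (q k) (q l) + g (y k) (y l)"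
      unfolding xk using qk ql y kl qy I.sub I.ip_commute[of "y k" "q l"]
      by (simp add: I.ip_add_left I.ip_add_right subspace_add)
    finally show ?thesis using orth E_bounds kl r by (auto simp: field_simps split: if_splits)
  qed
  have ge: "r\<^sup>2 \<le> d k" if "k \<in> E" for k
    using I.ip_nonneg[OF y(1)[OF that]] yy[OF that that] r by (simp add: field_simps)
  define P where "P = {k\<in>E. d k \<noteq> r\<^sup>2}"
  have PE: "P \<subseteq> E" by (auto simp: P_def)
  have finP: "finite P" using E(1) PE finite_subset by blast
  \<comment> \<open>\<open>q 0\<close>, the \<open>q k\<close> with \<open>k \<in> E\<close> and the nonzero \<open>y k\<close> are \<open>m + 1 + card P\<close> orthogonal vectors of \<open>I\<close>\<close>
  define K where "K = insert 0 E \<union> (+) n ` P"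
  have "card K = card (insert 0 E) + card ((+) n ` P)"
    unfolding K_def using E finP E_bounds by (intro card_Un_disjoint) auto
  also have "card ((+) n ` P) = card P" by (rule card_image) simp
  also have "card (insert 0 E) = Suc m" using E E_bounds by (subst card_insert_disjoint) auto
  finally have cK: "card K = Suc m + card P" .
  \<comment> \<open>Indices below \<open>n\<close> hold vectors \<open>q k\<close>; the shift by
    \<open>n\<close> keeps the indices of the vectors \<open>y k\<close> apart from them.\<close>
  define z where "z k = (if k < n then q k else y (k - n))" for k
  have zq: "z k = q k" if "k \<in> insert 0 E" for k using that E_bounds E by (auto simp: z_def)
  have zy: "z (n + k) = y k" for k by (simp add: z_def)
  have cases: "(k \<in> insert 0 E \<and> z k = q k \<and> k < n) \<or> (\<exists>p. p \<in> P \<and> p \<in> E \<and> k = n + p \<and> z k = y p)" if "k \<in> K" for k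
    using that zq zy PE E_bounds E(3) unfolding K_def by blast
  have "card K \<le> card ((\<lambda>j. b (Suc j)) ` {..<n})"
  proof (rule I.orthogonal_family_card_le[of _ z])
    fix k assume k: "k \<in> K"
    show "z k \<in> I" using cases[OF k] q y by metis
    have "g (z k) (z k) \<noteq> 0"
      using cases[OF k] orth[of k k] yy r by (auto simp: P_def)
    then show "z k \<noteq> 0" using I.ip_zero_left[OF subspace_0[OF I.sub]] by auto
    fix l assume l: "l \<in> K" "k \<noteq> l"
    show "g (z k) (z l) = 0"
    proof -
      have "g (y p) (q j) = 0" if "p \<in> E" "j \<in> insert 0 E" "j < n" for p j
        using I.ip_commute[OF y(1)[OF that(1)] q[OF that(3)]] qy that by simp
      then show ?thesis
        using cases[OF k] cases[OF l(1)] l(2) orth[of k l] yy qy by (elim disjE conjE exE) simp_all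
    qed
  qed (use E finP bI_span in \<open>auto simp: K_def\<close>)
  also have "\<dots> \<le> n" using card_image_le[of "{..<n}"] by simp
  finally have le: "Suc m + card P \<le> n" using cK by simp
  show ?thesis
  proof (cases "P = E")
    \<comment> \<open>Here \<open>r\<close> may be smaller than every singular value, but
      \<open>2 * m + 1 \<le> n\<close> makes the required bound at most 0.\<close>
    case True
    then show ?thesis using le E(4) by simp
  next
    case False
    then obtain k0 where k0: "k0 \<in> E" "d k0 = r\<^sup>2" by (auto simp: P_def)
    have "Min (sqrt ` d ` E) = r"
    proof (rule Min_eqI)
      fix s assume "s \<in> sqrt ` d ` E"
      then show "r \<le> s" using ge r by (auto intro!: real_le_rsqrt)
    next
      show "r \<in> sqrt ` d ` E" using k0 r by (intro image_eqI[of _ _ "r\<^sup>2"] image_eqI[of _ _ k0]) auto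
    qed (use E in auto)
    then have "singular_value_multiplicity (tilde_mat A) (Min (singular_values (tilde_mat A))) =
        card {k\<in>E. d k = r\<^sup>2}"
      using mult[of r] r by (simp add: sv)
    also have "{k\<in>E. d k = r\<^sup>2} = E - P" by (auto simp: P_def)
    also have "card (E - P) = m - card P" using PE finP E(4) by (simp add: card_Diff_subset)
    finally show ?thesis using le by simp
  qed
qed

text \<open>The least singular value \<open>s\<close> serves as scale factor. The multiplicity bound
  says that at most \<open>n - 1 - m\<close> indices in \<open>E\<close> need a correction, and
  there are exactly that many kernel vectors \<open>q j\<close> with positive \<open>j\<close>
  outside \<open>E\<close>.\<close>

lemma multiplicity_imp_similarity:
  assumes m: "0 < m"
    and mu: "int (singular_value_multiplicity (tilde_mat A) (Min (singular_values (tilde_mat A))))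
      \<ge> 2 * int m - int n + 1"
  shows "central_projection_then_similarity I g J g' f"
proof -
  define s where "s = Min (sqrt ` d ` E)"
  have fin: "finite (sqrt ` d ` E)" "sqrt ` d ` E \<noteq> {}" using E m by auto
  have "s \<in> sqrt ` d ` E" unfolding s_def using fin by (rule Min_in)
  then have s: "0 < s" using dpos by auto
  have ge: "s\<^sup>2 \<le> d k" if "k \<in> E" for k
  proof -
    have "s \<le> sqrt (d k)" unfolding s_def using fin that by (intro Min_le) auto
    then show ?thesis using s dpos[OF that] by (metis less_imp_le power_mono real_sqrt_pow2)
  qed
  define P where "P = {k\<in>E. d k \<noteq> s\<^sup>2}"
  have PE: "P \<subseteq> E" by (auto simp: P_def)
  have finP: "finite P" using E(1) PE finite_subset by blast
  have "{k\<in>E. d k = s\<^sup>2} = E - P" by (auto simp: P_def)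
  then have "2 * int m - int n + 1 \<le> int (card (E - P))"
    using mu mult[of s] s by (simp add: sv s_def)
  also have "card (E - P) = m - card P" using PE finP E(4) by (simp add: card_Diff_subset)
  finally have "card P + m + 1 \<le> n"
    using card_mono[OF E(1) PE] E(4) by linarith
  moreover have "card ({0<..<n} - E) = n - 1 - m"
    using E by (simp add: card_Diff_subset)
  ultimately have "card P \<le> card ({0<..<n} - E)" by simp
  then obtain p where p: "p ` P \<subseteq> {0<..<n} - E" "inj_on p P"
    using card_le_inj[OF finP, of "{0<..<n} - E"] by auto
  \<comment> \<open>Chosen so that \<open>q k + y k\<close> has squared length
    \<open>d k / s\<^sup>2\<close>. Indices outside \<open>P\<close> already have
    \<open>d k = s\<^sup>2\<close> within \<open>E\<close> and get no correction; injectivity of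
    \<open>p\<close> keeps the corrections orthogonal.\<close>
  define y where "y k = (if k \<in> P then sqrt (d k / s\<^sup>2 - 1) *\<^sub>R q (p k) else 0)" for k
  have pk: "0 < p k" "p k < n" "p k \<notin> E" if "k \<in> P" for k using p that by auto
  have y: "y k \<in> I" "f (y k) = 0" for k
    using pk q fz by (auto simp: y_def linear_scale[OF lin] linear_0[OF lin] intro: subspace_scale[OF I.sub] subspace_0[OF I.sub])
  have qy: "g (q k) (y l) = 0" if "k \<in> E" for k l
    using that pk q E_bounds orth by (auto simp: y_def I.ip_scale_right I.ip_zero_right)
  have yy: "g (y k) (y l) = (if k = l then d k / s\<^sup>2 - 1 else 0)" if "k \<in> E" "l \<in> E" for k l
  proof (cases "k \<in> P \<and> l \<in> P")
    case True
    have "0 \<le> d k / s\<^sup>2 - 1" using ge[OF that(1)] s by (simp add: field_simps)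
    then show ?thesis
      using True pk q orth p(2) by (auto simp: y_def I.ip_scale_left I.ip_scale_right subspace_scale[OF I.sub] inj_on_eq_iff)
  next
    case False
    then have "y k = 0 \<or> y l = 0" by (auto simp: y_def)
    then have "g (y k) (y l) = 0" using I.ip_zero_left I.ip_zero_right y(1) by metis
    moreover have "k = l \<Longrightarrow> d k / s\<^sup>2 - 1 = 0" using False that s by (auto simp: P_def)
    ultimately show ?thesis by auto
  qed
  have fqy: "f (q k + y k) = f (q k)" for k by (simp add: linear_add[OF lin] y)
  obtain T where "complementary T (lin_kernel f)" "collineation_is_similarity I g J g' f T"
  proof (rule similarity_from_orthogonal_family[of E "\<lambda>k. q k + y k" "\<lambda>k. d k / s\<^sup>2" s])
    show "q k + y k \<in> I" if "k \<in> E" for k using that q E_bounds y I.sub by (simp add: subspace_add)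
    show "g (q k + y k) (q l + y l) = (if k = l then d k / s\<^sup>2 else 0)" if kl: "k \<in> E" "l \<in> E" for k l
    proof -
      have qk: "q k \<in> I" and ql: "q l \<in> I" using q E_bounds kl by auto
      have "g (y k) (q l) = 0" using I.ip_commute[OF y(1) ql] qy[OF kl(2)] by simp
      then have "g (q k + y k) (q l + y l) = g (q k) (q l) + g (y k) (y l)"
        using qk ql y qy[OF kl(1)] I.sub by (simp add: I.ip_add_left I.ip_add_right subspace_add)
      then show ?thesis using orth E_bounds kl yy[OF kl] by simp
    qed
  qed (use E fqy fq E_bounds Jspan forth s in auto)
  then show ?thesis by (auto simp: central_projection_then_similarity_def)
qed

end

theorem theorem1:
  fixes n m :: nat
    and I :: "'v::real_vector set" and g :: "'v \<Rightarrow> 'v \<Rightarrow> real"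
    and J :: "'w::real_vector set" and g' :: "'w \<Rightarrow> 'w \<Rightarrow> real"
    and f :: "'v \<Rightarrow> 'w" and b :: "nat \<Rightarrow> 'v" and c :: "nat \<Rightarrow> 'w"
    and A :: "real mat"
  assumes "n \<ge> 3" and "2 \<le> m" and "m < n"
    and "dim (UNIV :: 'v set) = n + 1"
    and "subspace I" and "dim I = n" and "inner_product_on I g"
    and "dim (UNIV :: 'w set) = m + 1"
    and "subspace J" and "dim J = m" and "inner_product_on J g'"
    and "linear f" and "\<not> lin_kernel f \<subseteq> I" and "range f = UNIV"
    and "basis_family {0..n} b UNIV" and "orthonormal_basis_family {1..n} b I g"
    and "basis_family {0..m} c UNIV" and "orthonormal_basis_family {1..m} c J g'"
    and "A \<in> carrier_mat (m + 1) (n + 1)"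
    and "\<forall>j\<in>{0..n}. f (b j) = (\<Sum>i=0..m. A $$ (i, j) *\<^sub>R c i)"
  shows "(central_projection_then_similarity I g J g' f \<longleftrightarrow>
            int (singular_value_multiplicity (tilde_mat A) (Min (singular_values (tilde_mat A))))
              \<ge> 2 * int m - int n + 1) \<and>
         (orthogonal_central_projection_then_similarity I g J g' f \<longleftrightarrow>
            (\<exists>v>0. tilde_mat A * (tilde_mat A)\<^sup>T = mat_diag m (\<lambda>_. v)))"
proof -
  interpret central_map I g J g' n m f b c A
    using assms by (intro central_map.intro inner_product_subspace.intro central_map_axioms.intro)
  obtain q d E where "singular_basis I g J g' n m f b c A q d E"
    using singular_basis_exists by blast
  then interpret singular_basis I g J g' n m f b c A q d E .
  \<comment> \<open>Ensures that the set of singular values is nonempty, so that its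
    \<open>Min\<close> is meaningful.\<close>
  have "0 < m" using \<open>2 \<le> m\<close> by simp
  then show ?thesis
    using similarity_imp_multiplicity multiplicity_imp_similarity orthogonal_similarity_iff
    by (auto simp: central_projection_then_similarity_def)
qed

end
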